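(* There is an algorithm that, given a graph $G$ with $n$ vertices and $m$ edges, lists all avoidable vertices of $G$ in $O(n^2+m^2)$ time.
   Context: All graphs are finite, simple and undirected. A vertex $v$ of a graph $G$ is avoidable if every induced path on three vertices with middle vertex $v$ is contained in an induced cycle of $G$. *)

theory Defs
  imports Main
begin

section \<open>Graphs and avoidable vertices\<close>

definition simple_graph :: "'a set \<Rightarrow> 'a set set \<Rightarrow> bool" where
  "simple_graph V E \<longleftrightarrow> finite V \<and> (\<forall>e\<in>E. e \<subseteq> V \<and> card e = 2)"

definition induced_path :: "'a set \<Rightarrow> 'a set set \<Rightarrow> 'a list \<Rightarrow> bool" where
  "induced_path V E p \<longleftrightarrow> p \<noteq> [] \<and> distinct p \<and> set p \<subseteq> V \<and>
     (\<forall>i j. i < j \<and> j < length p \<longrightarrow> ({p ! i, p ! j} \<in> E \<longleftrightarrow> j = i + 1))"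

definition induced_cycle :: "'a set \<Rightarrow> 'a set set \<Rightarrow> 'a list \<Rightarrow> bool" where
  "induced_cycle V E c \<longleftrightarrow> length c \<ge> 3 \<and> distinct c \<and> set c \<subseteq> V \<and>
     (\<forall>i j. i < j \<and> j < length c \<longrightarrow>
        ({c ! i, c ! j} \<in> E \<longleftrightarrow> j = i + 1 \<or> (i = 0 \<and> j = length c - 1)))"

text \<open>
  Paths and cycles are both induced, so containment of the path in the cycle as a subgraph
  is the same as containment of vertex sets.
\<close>

definition avoidable :: "'a set \<Rightarrow> 'a set set \<Rightarrow> 'a \<Rightarrow> bool" where
  "avoidable V E v \<longleftrightarrow> v \<in> V \<and>
     (\<forall>x y. induced_path V E [x, v, y] \<longrightarrow>
        (\<exists>c. induced_cycle V E c \<and> set [x, v, y] \<subseteq> set c))"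

section \<open>Word RAM programs and their running time\<close>

text \<open>
  Unit-cost RAM with words of \<open>w\<close> bits. Programs address registers by constants and reach the
  memory only indirectly, through an address held in a register. Addition wraps around modulo
  \<open>2 ^ w\<close>; subtraction is truncated at 0. There is a write-only output tape.
\<close>

type_synonym reg = nat

datatype com =
    Skip
  | Const reg nat      \<comment> \<open>\<open>r := k\<close>\<close>
  | Add reg reg reg    \<comment> \<open>\<open>r := a + b\<close>\<close>
  | Sub reg reg reg    \<comment> \<open>\<open>r := a - b\<close>\<close>
  | Load reg reg       \<comment> \<open>\<open>r := M[a]\<close>\<close>
  | Store reg reg      \<comment> \<open>\<open>M[a] := r\<close>, with the address register \<open>a\<close> first\<close>
  | Output reg
  | Seq com com
  | IfLess reg reg com com
  | WhileLess reg reg com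

record ram_state =
  regs :: "reg \<Rightarrow> nat"
  mem :: "nat \<Rightarrow> nat"
  outp :: "nat list"

text \<open>\<open>exec w P s t s'\<close>: with word length \<open>w\<close>, program \<open>P\<close> started in \<open>s\<close> halts in \<open>s'\<close> after
  exactly \<open>t\<close> steps, where every instruction and every evaluation of a test is one step.\<close>

inductive exec :: "nat \<Rightarrow> com \<Rightarrow> ram_state \<Rightarrow> nat \<Rightarrow> ram_state \<Rightarrow> bool" for w :: nat where
  Skip: "exec w Skip s 1 s"
| Const: "exec w (Const r k) s 1 (s\<lparr>regs := (regs s)(r := k mod 2 ^ w)\<rparr>)"
| Add: "exec w (Add r a b) s 1 (s\<lparr>regs := (regs s)(r := (regs s a + regs s b) mod 2 ^ w)\<rparr>)"
| Sub: "exec w (Sub r a b) s 1 (s\<lparr>regs := (regs s)(r := regs s a - regs s b)\<rparr>)"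
| Load: "exec w (Load r a) s 1 (s\<lparr>regs := (regs s)(r := mem s (regs s a))\<rparr>)"
| Store: "exec w (Store a r) s 1 (s\<lparr>mem := (mem s)(regs s a := regs s r)\<rparr>)"
| Output: "exec w (Output r) s 1 (s\<lparr>outp := outp s @ [regs s r]\<rparr>)"
| Seq: "exec w P s t s' \<Longrightarrow> exec w Q s' t' s'' \<Longrightarrow> exec w (Seq P Q) s (t + t') s''"
| IfTrue: "regs s a < regs s b \<Longrightarrow> exec w P s t s' \<Longrightarrow> exec w (IfLess a b P Q) s (t + 1) s'"
| IfFalse: "\<not> regs s a < regs s b \<Longrightarrow> exec w Q s t s' \<Longrightarrow> exec w (IfLess a b P Q) s (t + 1) s'"
| WhileFalse: "\<not> regs s a < regs s b \<Longrightarrow> exec w (WhileLess a b P) s 1 s"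
| WhileTrue: "regs s a < regs s b \<Longrightarrow> exec w P s t s' \<Longrightarrow> exec w (WhileLess a b P) s' t' s'' \<Longrightarrow>
    exec w (WhileLess a b P) s (t + t' + 1) s''"

inductive_cases Skip_E: "exec w Skip s t s'"
inductive_cases Const_E: "exec w (Const r k) s t s'"
inductive_cases Add_E: "exec w (Add r a b) s t s'"
inductive_cases Sub_E: "exec w (Sub r a b) s t s'"
inductive_cases Load_E: "exec w (Load r a) s t s'"
inductive_cases Store_E: "exec w (Store a r) s t s'"
inductive_cases Output_E: "exec w (Output r) s t s'"
inductive_cases Seq_E: "exec w (Seq P Q) s t s'"
inductive_cases If_E: "exec w (IfLess a b P Q) s t s'"
inductive_cases While_E: "exec w (WhileLess a b P) s t s'"

lemma exec_deterministic:
  "exec w P s t s' \<Longrightarrow> exec w P s u s'' \<Longrightarrow> u = t \<and> s'' = s'"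
proof (induction arbitrary: u s'' rule: exec.induct)
  case (Seq P s t s' Q t' s2)
  from Seq.prems obtain u1 r u2 where "exec w P s u1 r" "exec w Q r u2 s''" "u = u1 + u2"
    by (rule Seq_E)
  with Seq.IH show ?case by metis
next
  case (IfTrue s a b P t s' Q)
  from IfTrue.prems obtain u1 where "exec w P s u1 s''" "u = u1 + 1"
    by (rule If_E) (use IfTrue.hyps in simp_all)
  with IfTrue.IH show ?case by metis
next
  case (IfFalse s a b Q t s' P)
  from IfFalse.prems obtain u1 where "exec w Q s u1 s''" "u = u1 + 1"
    by (rule If_E) (use IfFalse.hyps in simp_all)
  with IfFalse.IH show ?case by metis
next
  case (WhileFalse s a b P)
  from WhileFalse.prems show ?case
    by (rule While_E) (use WhileFalse.hyps in simp_all)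
next
  case (WhileTrue s a b P t s' t' s2)
  from WhileTrue.prems obtain u1 r u2
    where "exec w P s u1 r" "exec w (WhileLess a b P) r u2 s''" "u = u1 + u2 + 1"
    by (rule While_E) (use WhileTrue.hyps in simp_all)
  with WhileTrue.IH show ?case by metis
qed (erule Skip_E Const_E Add_E Sub_E Load_E Store_E Output_E, simp)+

definition init_state :: "nat list \<Rightarrow> ram_state" where
  "init_state xs =
     \<lparr>regs = (\<lambda>_. 0), mem = (\<lambda>i. if i < length xs then xs ! i else 0), outp = []\<rparr>"

section \<open>Graphs as inputs\<close>

definition adjacency_lists :: "nat \<Rightarrow> nat set set \<Rightarrow> nat list list \<Rightarrow> bool" where
  "adjacency_lists n E adj \<longleftrightarrow> length adj = n \<and>
     (\<forall>v<n. distinct (adj ! v) \<and> set (adj ! v) = {u. {v, u} \<in> E})"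

text \<open>
  Address 0 holds \<open>n\<close>; addresses \<open>1, \<dots>, n + 1\<close> hold pointers such that the neighbours of \<open>v\<close>
  occupy the addresses from \<open>M[v + 1]\<close> (inclusive) to \<open>M[v + 2]\<close> (exclusive).
\<close>

definition encode :: "nat list list \<Rightarrow> nat list" where
  "encode adj = (let n = length adj in
     n # map (\<lambda>v. n + 2 + length (concat (take v adj))) [0..<n + 1] @ concat adj)"

end

theory Submission imports Defs begin

text \<open>
  Let \<open>x\<close> and \<open>y\<close> be non-adjacent neighbours of \<open>v\<close>. A shortest path from \<open>x\<close> to \<open>y\<close> with interior
  outside the closed neighbourhood of \<open>v\<close> closes up through \<open>v\<close> to an induced cycle, and every
  induced cycle through \<open>x, v, y\<close> arises from such a path. Hence \<open>v\<close> is avoidable iff for each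
  neighbour \<open>x\<close> of \<open>v\<close>, a search from \<open>x\<close> that never expands \<open>v\<close> or another neighbour of \<open>v\<close> meets
  all neighbours of \<open>v\<close>. One search takes \<open>O(n + m)\<close> time, and there are \<open>2 m\<close> pairs \<open>(v, x)\<close>, so
  together with \<open>O(1)\<close> work per vertex the total is \<open>O(n + m (n + m))\<close>, within \<open>O(n\<^sup>2 + m\<^sup>2)\<close>.
\<close>

section \<open>Avoidability by restricted search\<close>

text \<open>Testing each path x, v, y separately would cost a search for every pair of neighbours of
  v. A single search from x settles all y at once, so there are only as many searches as ordered
  pairs (v, x) of adjacent vertices. Neighbours y of x need no special treatment: expanding x meets
  them immediately, so no adjacency test is required, which adjacency lists do not offer in constant
  time. On the machine two things have to be secured. Each search must be linear, hence the queue
  that no vertex enters twice: every vertex pays once for the scan of its own list. And addresses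
  must not wrap around, which the lower bound on \<open>2 ^ w\<close> prevents. The mixed term n m
  of the running time is absorbed by \<open>2 * (n * m) \<le> n\<^sup>2 + m\<^sup>2\<close>.\<close>

inductive reach :: "'a set set \<Rightarrow> 'a \<Rightarrow> 'a \<Rightarrow> 'a \<Rightarrow> bool" for E v x where
  start: "reach E v x x"
| step: "reach E v x u \<Longrightarrow> {u, z} \<in> E \<Longrightarrow> z \<noteq> v \<Longrightarrow> {v, z} \<notin> E \<Longrightarrow> reach E v x z"

text \<open>Although \<open>x\<close> is a neighbour of \<open>v\<close>, it is expanded, since
  \<open>start\<close> carries no side condition; so \<open>u = x\<close> witnesses every
  \<open>y\<close> adjacent to \<open>x\<close>.\<close>

definition good_neighbour :: "'a set set \<Rightarrow> 'a \<Rightarrow> 'a \<Rightarrow> bool" where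
  "good_neighbour E v x \<longleftrightarrow>
     (\<forall>y. {v, y} \<in> E \<longrightarrow> y = x \<or> (\<exists>u. reach E v x u \<and> {u, y} \<in> E))"

text \<open>A walk, given by a function whose values beyond \<open>L\<close> are arbitrary, so that
  cutting it is mere reindexing. Repetitions are allowed and disappear only for minimal
  \<open>L\<close>.\<close>

definition detour :: "'a set set \<Rightarrow> 'a \<Rightarrow> 'a \<Rightarrow> 'a \<Rightarrow> (nat \<Rightarrow> 'a) \<Rightarrow> nat \<Rightarrow> bool" where
  "detour E v x y f L \<longleftrightarrow> f 0 = x \<and> f L = y \<and> (\<forall>i<L. {f i, f (Suc i)} \<in> E) \<and>
     (\<forall>i. 0 < i \<and> i < L \<longrightarrow> f i \<noteq> v \<and> {v, f i} \<notin> E)"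

lemma edge_distinct:
  assumes "simple_graph V E" "{a, b} \<in> E"
  shows "a \<noteq> b" "a \<in> V" "b \<in> V"
proof -
  have "card {a, b} = 2" "{a, b} \<subseteq> V" using assms unfolding simple_graph_def by blast+
  then show "a \<noteq> b" "a \<in> V" "b \<in> V" by (auto simp: card_insert_if split: if_splits)
qed

text \<open>The induction generalises over the target: the walk to \<open>z\<close> is prolonged by
  \<open>y\<close>, and the side conditions of \<open>step\<close> make \<open>z\<close> a legal
  interior vertex.\<close>

lemma detour_if_reach:
  assumes "reach E v x u" "{u, y} \<in> E"
  shows "\<exists>f L. detour E v x y f L"
  using assms
proof (induction arbitrary: y)
  case start
  then have "detour E v x y (\<lambda>i. if i = 0 then x else y) 1" by (simp add: detour_def)
  then show ?case by blast
next
  case (step u z)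
  from step.IH[OF step.hyps(2)] obtain f L where f: "detour E v x z f L" by blast
  have "detour E v x y (f(Suc L := y)) (Suc L)"
    using f step.hyps step.prems unfolding detour_def by (auto simp: less_Suc_eq)
  then show ?case by blast
qed

text \<open>Repetitions and chords are cut in the same way, by skipping a block of indices. Every
  interior vertex of the new walk was interior before, so the restriction survives.\<close>

lemma detour_shortcut:
  assumes f: "detour E v x y f L" and ij: "i < j" "j \<le> L"
    and short: "f i = f j \<or> {f i, f j} \<in> E \<and> j \<noteq> Suc i"
  shows "\<exists>g L'. L' < L \<and> detour E v x y g L'"
proof -
  \<comment> \<open>A repetition merges \<open>f i\<close> and \<open>f j\<close>, removing
    \<open>j - i\<close> steps; a chord keeps both, removing one step fewer, still a positive number
    because \<open>j\<close> is not \<open>Suc i\<close>.\<close>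
  define d where "d = (if f i = f j then j - i else j - i - 1)"
  define g where "g = (\<lambda>k. if k \<le> i then f k else f (k + d))"
  have d: "0 < d" "d \<le> j - i" "f i \<noteq> f j \<Longrightarrow> i + d + 1 = j" "f i = f j \<Longrightarrow> i + d = j"
    using ij short by (auto simp: d_def)
  have edge: "{g k, g (Suc k)} \<in> E" if k: "k < L - d" for k
  proof -
    consider "k < i" | "k = i" | "k > i" by linarith
    then show ?thesis
    proof cases
      case 1
      then show ?thesis using f k by (simp add: g_def detour_def)
    next
      case 2
      show ?thesis
      proof (cases "f i = f j")
        case True
        then have "{f j, f (Suc j)} \<in> E" using f k 2 d ij by (simp add: detour_def)
        then show ?thesis using 2 d(4)[OF True] True by (simp add: g_def)
      next
        case False
        then show ?thesis using 2 d(3)[OF False] short by (simp add: g_def)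
      qed
    next
      case 3
      then show ?thesis using f k by (simp add: g_def detour_def)
    qed
  qed
  have last: "g (L - d) = y"
  \<comment> \<open>This case arises only when a repetition with \<open>j = L\<close> is cut; the
    new walk then ends at \<open>f i = f L\<close>.\<close>
  proof (cases "L - d \<le> i")
    case True
    then have "f i = f j" "L = j" "L - d = i" using d ij by (cases "f i = f j"; force)+
    then show ?thesis using f by (simp add: g_def detour_def)
  next
    case False
    then show ?thesis using f d ij by (simp add: g_def detour_def)
  qed
  have "detour E v x y g (L - d)"
    using f edge last ij d(1,2) by (auto simp: detour_def g_def)
  moreover have "L - d < L" using d ij by linarith
  ultimately show ?thesis by blast
qed

text \<open>By \<open>detour_shortcut\<close>, a detour of least length has neither repetitions nor
  chords, and \<open>v\<close> is adjacent to its two ends only.\<close>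

lemma induced_cycle_if_reach:
  assumes G: "simple_graph V E" and x: "{v, x} \<in> E" and y: "{v, y} \<in> E"
    and xy: "x \<noteq> y" "{x, y} \<notin> E" and r: "reach E v x u" "{u, y} \<in> E"
  shows "\<exists>c. induced_cycle V E c \<and> set [x, v, y] \<subseteq> set c"
proof -
  define L where "L = (LEAST L. \<exists>f. detour E v x y f L)"
  have "\<exists>f. detour E v x y f L"
    unfolding L_def using detour_if_reach[OF r]
    by (intro LeastI_ex[where P = "\<lambda>L. \<exists>f. detour E v x y f L"]) blast
  then obtain f where f: "detour E v x y f L" by blast
  have min: "\<not> detour E v x y g L'" if "L' < L" for g L'
    using not_less_Least[of L' "\<lambda>L. \<exists>f. detour E v x y f L"] that unfolding L_def by blast
  have neq: "f i \<noteq> f j" if "i < j" "j \<le> L" for i j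
    using detour_shortcut[OF f that] min by blast
  have edge: "{f i, f j} \<in> E \<longleftrightarrow> j = Suc i" if "i < j" "j \<le> L" for i j
  proof
    show "{f i, f j} \<in> E \<Longrightarrow> j = Suc i" using detour_shortcut[OF f that] min by blast
    show "j = Suc i \<Longrightarrow> {f i, f j} \<in> E" using f that by (simp add: detour_def)
  qed
  have ends: "f 0 = x" "f L = y" using f by (auto simp: detour_def)
  \<comment> \<open>Length 0 would force \<open>x = y\<close>, and length 1 an edge between
    them.\<close>
  have L: "L \<ge> 2"
  proof -
    have "L \<noteq> 0" using ends xy(1) by (cases L) auto
    moreover have "L \<noteq> 1" using ends xy(2) f by (auto simp: detour_def)
    ultimately show ?thesis by linarith
  qed
  have inner: "f i \<noteq> v \<and> {v, f i} \<notin> E" if "0 < i" "i < L" for i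
    using f that by (simp add: detour_def)
  have vf: "f i \<noteq> v" if "i \<le> L" for i
    using inner[of i] that ends edge_distinct(1)[OF G x] edge_distinct(1)[OF G y]
    by (cases "i = 0"; cases "i = L") auto
  have ve: "{v, f i} \<in> E \<longleftrightarrow> i = 0 \<or> i = L" if "i \<le> L" for i
    using inner[of i] that ends x y by (cases "i = 0"; cases "i = L") auto
  have fV: "f i \<in> V" if "i \<le> L" for i
  proof (cases "i < L")
    case True
    then show ?thesis using f edge_distinct(2)[OF G] unfolding detour_def by blast
  next
    case False
    then show ?thesis using that ends edge_distinct(3)[OF G y] by simp
  qed
  \<comment> \<open>With \<open>v\<close> in front, the closing edge singled out by
    \<open>induced_cycle\<close> is the one between \<open>v\<close> and \<open>y\<close>.\<close>
  define c where "c = v # map f [0..<Suc L]"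
  have len: "length c = L + 2" by (simp add: c_def)
  have nth: "c ! Suc i = f i" if "i \<le> L" for i
    using that by (simp add: c_def nth_append del: upt_Suc)
  have "inj_on f {0..<Suc L}"
    by (rule inj_onI) (metis neq atLeastLessThan_iff less_Suc_eq_le linorder_neqE_nat)
  moreover have "v \<notin> f ` {0..<Suc L}" using vf by (metis atLeastLessThan_iff imageE less_Suc_eq_le)
  ultimately have "distinct c" by (simp add: c_def distinct_map del: upt_Suc)
  moreover have "set c \<subseteq> V" using fV x edge_distinct(2)[OF G x]
    by (auto simp: c_def less_Suc_eq_le simp del: upt_Suc)
  moreover have "{c ! i, c ! j} \<in> E \<longleftrightarrow> j = i + 1 \<or> (i = 0 \<and> j = length c - 1)"
    if ij: "i < j" "j < length c" for i j
  proof -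
    obtain j' where j': "j = Suc j'" "j' \<le> L" using ij len by (cases j) auto
    show ?thesis
    proof (cases i)
      case 0
      then show ?thesis using j' nth ve len by (auto simp: c_def simp del: upt_Suc)
    next
      case (Suc i')
      then show ?thesis using j' ij nth edge[of i' j'] len by simp
    qed
  qed
  ultimately have "induced_cycle V E c" using len L by (simp add: induced_cycle_def)
  moreover have "set [x, v, y] \<subseteq> set c" using ends by (auto simp: c_def simp del: upt_Suc)
  ultimately show ?thesis by blast
qed

text \<open>The definition of \<open>induced_cycle\<close> treats position 0 specially; rotation
  invariance allows \<open>v\<close> to be moved there.\<close>

lemma induced_cycle_rotate1:
  assumes c: "induced_cycle V E c"
  shows "induced_cycle V E (rotate1 c)"
proof -
  have len: "length c \<ge> 3" and edge: "\<And>i j. i < j \<Longrightarrow> j < length c \<Longrightarrow>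
      ({c ! i, c ! j} \<in> E \<longleftrightarrow> j = i + 1 \<or> (i = 0 \<and> j = length c - 1))"
    using c by (auto simp: induced_cycle_def)
  have nth: "rotate1 c ! i = (if Suc i = length c then c ! 0 else c ! Suc i)" if "i < length c" for i
    using that nth_rotate1[of i c] by (auto simp: mod_Suc)
  have "{rotate1 c ! i, rotate1 c ! j} \<in> E \<longleftrightarrow> j = i + 1 \<or> (i = 0 \<and> j = length c - 1)"
    if ij: "i < j" "j < length c" for i j
  proof (cases "Suc j = length c")
    case True
    then have "{rotate1 c ! i, rotate1 c ! j} = {c ! 0, c ! Suc i}" using nth ij by auto
    then show ?thesis using edge[of 0 "Suc i"] ij True by auto
  next
    case False
    then show ?thesis using nth ij edge[of "Suc i" "Suc j"] by auto
  qed
  then show ?thesis using c by (auto simp: induced_cycle_def)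
qed

lemma induced_cycle_rotate: "induced_cycle V E c \<Longrightarrow> induced_cycle V E (rotate k c)"
  by (induction k) (auto intro: induced_cycle_rotate1)

text \<open>With \<open>v\<close> at position 0, its neighbours on the cycle sit at positions 1 and
  \<open>N - 1\<close>, and the search can follow the arc between them. A triangle is covered as
  well, with \<open>u = x\<close>.\<close>

lemma reach_if_induced_cycle:
  assumes G: "simple_graph V E" and x: "{v, x} \<in> E" and y: "{v, y} \<in> E" and xy: "x \<noteq> y"
    and c0: "induced_cycle V E c0" "set [x, v, y] \<subseteq> set c0"
  shows "\<exists>u. reach E v x u \<and> {u, y} \<in> E"
proof -
  obtain k where k: "k < length c0" "c0 ! k = v" using c0(2) by (auto simp: in_set_conv_nth)
  define c where "c = rotate k c0"
  define N where "N = length c"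
  have c: "induced_cycle V E c" and sub: "x \<in> set c" "y \<in> set c"
    using induced_cycle_rotate[OF c0(1)] c0(2) by (auto simp: c_def)
  have N3: "N \<ge> 3" and dc: "distinct c" and edge: "\<And>i j. i < j \<Longrightarrow> j < N \<Longrightarrow>
      ({c ! i, c ! j} \<in> E \<longleftrightarrow> j = i + 1 \<or> (i = 0 \<and> j = N - 1))"
    using c by (auto simp: induced_cycle_def N_def)
  have "c ! 0 = c0 ! ((k + 0) mod length c0)"
    unfolding c_def by (rule nth_rotate) (use k in linarith)
  then have c0v: "c ! 0 = v" using k by simp
  have nb: "\<exists>i. z = c ! i \<and> (i = 1 \<or> i = N - 1)" if z: "z \<in> set c" "{v, z} \<in> E" for z
  proof -
    obtain i where i: "i < N" "z = c ! i" using z by (auto simp: in_set_conv_nth N_def)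
    have "i \<noteq> 0" using i c0v edge_distinct(1)[OF G z(2)] by metis
    then show ?thesis using edge[of 0 i] i z c0v by auto
  qed
  have far: "c ! i \<noteq> v \<and> {v, c ! i} \<notin> E" if "1 < i" "i < N - 1" for i
  proof -
    have "i < length c" "0 < length c" using that by (auto simp: N_def)
    then have "c ! i \<noteq> c ! 0" using nth_eq_iff_index_eq[OF dc] that by simp
    then show ?thesis using edge[of 0 i] that c0v by simp
  qed
  consider "x = c ! 1" "y = c ! (N - 1)" | "x = c ! (N - 1)" "y = c ! 1"
    using nb[OF sub(1) x] nb[OF sub(2) y] xy by blast
  then show ?thesis
  proof cases
    case 1
    \<comment> \<open>The bound stops short of position \<open>N - 1\<close>, which holds
      \<open>y\<close> and is barred to the search.\<close>
    have all: "reach E v x (c ! Suc i)" if "Suc i < N - 1" for i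
      using that
    proof (induction i)
      case 0
      then show ?case using 1 by (simp add: reach.start)
    next
      case (Suc i)
      have "{c ! Suc i, c ! Suc (Suc i)} \<in> E" using edge[of "Suc i" "Suc (Suc i)"] Suc.prems by simp
      with reach.step[of E v x "c ! Suc i"] show ?case
        using Suc.IH Suc.prems far[of "Suc (Suc i)"] by simp
    qed
    have "Suc (N - 3) = N - 2" "N - 2 < N - 1" using N3 by linarith+
    then have "reach E v x (c ! (N - 2))" using all[of "N - 3"] by simp
    moreover have "{c ! (N - 2), y} \<in> E" using edge[of "N - 2" "N - 1"] N3 1 by simp
    ultimately show ?thesis by blast
  next
    case 2
    \<comment> \<open>The same arc backwards, from \<open>x\<close> at position \<open>N - 1\<close>
      down to position 2.\<close>
    have all: "reach E v x (c ! (N - Suc i))" if "Suc i < N - 1" for i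
      using that
    proof (induction i)
      case 0
      then show ?case using 2 by (simp add: reach.start)
    next
      case (Suc i)
      have "{c ! (N - Suc (Suc i)), c ! (N - Suc i)} \<in> E"
        using edge[of "N - Suc (Suc i)" "N - Suc i"] Suc.prems Suc_diff_Suc[of "Suc i" N] by simp
      then have "{c ! (N - Suc i), c ! (N - Suc (Suc i))} \<in> E" by (simp add: insert_commute)
      moreover have "1 < N - Suc (Suc i)" "N - Suc (Suc i) < N - 1" using Suc.prems by linarith+
      ultimately show ?case using reach.step[of E v x "c ! (N - Suc i)"]
        Suc.IH Suc.prems far[of "N - Suc (Suc i)"] by simp
    qed
    have "N - Suc (N - 3) = 2" "Suc (N - 3) < N - 1" using N3 by linarith+
    then have "reach E v x (c ! 2)" using all[of "N - 3"] by simp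
    moreover have "{c ! 2, y} \<in> E" using edge[of 1 2] N3 2 by (simp add: insert_commute)
    ultimately show ?thesis by blast
  qed
qed

theorem avoidable_iff_good_neighbours:
  assumes G: "simple_graph V E"
  shows "avoidable V E v \<longleftrightarrow> v \<in> V \<and> (\<forall>x. {v, x} \<in> E \<longrightarrow> good_neighbour E v x)"
proof -
  have path: "induced_path V E [x, v, y] \<longleftrightarrow>
      x \<noteq> y \<and> {v, x} \<in> E \<and> {v, y} \<in> E \<and> {x, y} \<notin> E" (is "?l \<longleftrightarrow> ?r") for x y
  proof -
    have "?l \<longleftrightarrow> distinct [x, v, y] \<and> set [x, v, y] \<subseteq> V \<and>
        {x, v} \<in> E \<and> {v, y} \<in> E \<and> {x, y} \<notin> E"
    proof -
      have "(\<forall>i j. i < j \<and> j < length [x, v, y] \<longrightarrow> R i j) \<longleftrightarrow> R 0 1 \<and> R 1 2 \<and> R 0 2" for R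
        by (auto simp: less_Suc_eq numeral_2_eq_2)
      then show ?thesis unfolding induced_path_def by simp
    qed
    also have "\<dots> \<longleftrightarrow> ?r"
      using edge_distinct[OF G, of v x] edge_distinct[OF G, of v y] insert_commute[of x v "{}"]
      by auto
    finally show ?thesis .
  qed
  show ?thesis
  proof (intro iffI conjI allI impI)
    assume "avoidable V E v"
    then show "v \<in> V" by (simp add: avoidable_def)
  next
    fix x assume av: "avoidable V E v" and x: "{v, x} \<in> E"
    show "good_neighbour E v x"
      unfolding good_neighbour_def
    proof (intro allI impI)
      fix y assume y: "{v, y} \<in> E"
      show "y = x \<or> (\<exists>u. reach E v x u \<and> {u, y} \<in> E)"
      proof (cases "y = x \<or> {x, y} \<in> E")
        case True
        \<comment> \<open>If \<open>x\<close> and \<open>y\<close> are adjacent,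
          \<open>u = x\<close> meets \<open>y\<close> without any cycle.\<close>
        then show ?thesis using reach.start[of E v x] by blast
      next
        case False
        then have "induced_path V E [x, v, y]" using path x y by blast
        then show ?thesis using av reach_if_induced_cycle[OF G x y] False
          unfolding avoidable_def by blast
      qed
    qed
  next
    assume "v \<in> V \<and> (\<forall>x. {v, x} \<in> E \<longrightarrow> good_neighbour E v x)"
    then show "avoidable V E v"
      unfolding avoidable_def good_neighbour_def path
      using induced_cycle_if_reach[OF G, of v] by blast
  qed
qed

section \<open>Timed Hoare logic\<close>

text \<open>Total correctness within a time budget. Asking for some run is enough, because
  \<open>exec\<close> is deterministic.\<close>

definition runs :: "nat \<Rightarrow> com \<Rightarrow> ram_state \<Rightarrow> nat \<Rightarrow> (ram_state \<Rightarrow> bool) \<Rightarrow> bool" where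
  "runs w P s T Q \<longleftrightarrow> (\<exists>t s'. exec w P s t s' \<and> t \<le> T \<and> Q s')"

lemma runs_mono: "runs w P s T Q \<Longrightarrow> T \<le> T' \<Longrightarrow> (\<And>s'. Q s' \<Longrightarrow> Q' s') \<Longrightarrow> runs w P s T' Q'"
  unfolding runs_def by (meson le_trans)

lemma runs_Seq:
  assumes "runs w P s T Q" "T \<le> T'" "\<And>s'. Q s' \<Longrightarrow> runs w P' s' (T' - T) Q'"
  shows "runs w (Seq P P') s T' Q'"
proof -
  obtain t s' where 1: "exec w P s t s'" "t \<le> T" "Q s'" using assms(1) by (auto simp: runs_def)
  obtain t' s'' where "exec w P' s' t' s''" "t' \<le> T' - T" "Q' s''"
    using assms(3)[OF 1(3)] by (auto simp: runs_def)
  then show ?thesis using 1 assms(2) exec.Seq unfolding runs_def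
    by (metis add_le_mono le_add_diff_inverse)
qed

lemma runs_Seq_add:
  "runs w P s T Q \<Longrightarrow> (\<And>s'. Q s' \<Longrightarrow> runs w P' s' T' Q') \<Longrightarrow> runs w (Seq P P') s (T + T') Q'"
  by (rule runs_Seq[of w P s T Q]) simp_all

lemma exec_basic:
  "exec w Skip s t s' \<longleftrightarrow> t = 1 \<and> s' = s"
  "exec w (Const r k) s t s' \<longleftrightarrow> t = 1 \<and> s' = s\<lparr>regs := (regs s)(r := k mod 2 ^ w)\<rparr>"
  "exec w (Add r a b) s t s' \<longleftrightarrow>
     t = 1 \<and> s' = s\<lparr>regs := (regs s)(r := (regs s a + regs s b) mod 2 ^ w)\<rparr>"
  "exec w (Load r a) s t s' \<longleftrightarrow> t = 1 \<and> s' = s\<lparr>regs := (regs s)(r := mem s (regs s a))\<rparr>"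
  "exec w (Store a r) s t s' \<longleftrightarrow> t = 1 \<and> s' = s\<lparr>mem := (mem s)(regs s a := regs s r)\<rparr>"
  "exec w (Output r) s t s' \<longleftrightarrow> t = 1 \<and> s' = s\<lparr>outp := outp s @ [regs s r]\<rparr>"
  by (auto elim!: Skip_E Const_E Add_E Load_E Store_E Output_E
      intro: exec.intros(1-7)[unfolded One_nat_def])

lemma exec_Seq_iff:
  "exec w (Seq P P') s t s'' \<longleftrightarrow> (\<exists>t1 t2 s'. t = t1 + t2 \<and> exec w P s t1 s' \<and> exec w P' s' t2 s'')"
  by (blast elim: Seq_E intro: exec.Seq)

lemma exec_If_iff:
  "exec w (IfLess a b P P') s t s' \<longleftrightarrow>
     (\<exists>t1. t = t1 + 1 \<and> exec w (if regs s a < regs s b then P else P') s t1 s')"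
proof
  assume "exec w (IfLess a b P P') s t s'"
  then show "\<exists>t1. t = t1 + 1 \<and> exec w (if regs s a < regs s b then P else P') s t1 s'"
    by (rule If_E) auto
next
  assume "\<exists>t1. t = t1 + 1 \<and> exec w (if regs s a < regs s b then P else P') s t1 s'"
  then show "exec w (IfLess a b P P') s t s'"
    using exec.IfTrue[of s a b w P _ s' P'] exec.IfFalse[of s a b w P' _ s' P]
    by (cases "regs s a < regs s b") auto
qed

lemma runs_basic [simp]:
  "runs w Skip s T Q \<longleftrightarrow> 1 \<le> T \<and> Q s"
  "runs w (Const r k) s T Q \<longleftrightarrow> 1 \<le> T \<and> Q (s\<lparr>regs := (regs s)(r := k mod 2 ^ w)\<rparr>)"
  "runs w (Add r a b) s T Q \<longleftrightarrow>
     1 \<le> T \<and> Q (s\<lparr>regs := (regs s)(r := (regs s a + regs s b) mod 2 ^ w)\<rparr>)"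
  "runs w (Load r a) s T Q \<longleftrightarrow> 1 \<le> T \<and> Q (s\<lparr>regs := (regs s)(r := mem s (regs s a))\<rparr>)"
  "runs w (Store a r) s T Q \<longleftrightarrow> 1 \<le> T \<and> Q (s\<lparr>mem := (mem s)(regs s a := regs s r)\<rparr>)"
  "runs w (Output r) s T Q \<longleftrightarrow> 1 \<le> T \<and> Q (s\<lparr>outp := outp s @ [regs s r]\<rparr>)"
  by (auto simp: runs_def exec_basic)

lemma runs_Seq_unit:
  assumes "\<And>t s'. exec w P s t s' \<longleftrightarrow> t = 1 \<and> s' = u"
  shows "runs w (Seq P P') s T Q \<longleftrightarrow> 1 \<le> T \<and> runs w P' u (T - 1) Q"
proof
  assume "runs w (Seq P P') s T Q"
  then show "1 \<le> T \<and> runs w P' u (T - 1) Q"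
    unfolding runs_def exec_Seq_iff assms by fastforce
next
  assume "1 \<le> T \<and> runs w P' u (T - 1) Q"
  moreover have "runs w P s 1 (\<lambda>s'. s' = u)" using assms by (auto simp: runs_def)
  ultimately show "runs w (Seq P P') s T Q" by (auto intro: runs_Seq)
qed

text \<open>As simplification rules these execute straight-line code symbolically, each instruction
  taking one unit from the budget.\<close>

lemma runs_Seq_basic [simp]:
  "runs w (Seq Skip P') s T Q \<longleftrightarrow> 1 \<le> T \<and> runs w P' s (T - 1) Q"
  "runs w (Seq (Const r k) P') s T Q \<longleftrightarrow>
     1 \<le> T \<and> runs w P' (s\<lparr>regs := (regs s)(r := k mod 2 ^ w)\<rparr>) (T - 1) Q"
  "runs w (Seq (Add r a b) P') s T Q \<longleftrightarrow>
     1 \<le> T \<and> runs w P' (s\<lparr>regs := (regs s)(r := (regs s a + regs s b) mod 2 ^ w)\<rparr>) (T - 1) Q"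
  "runs w (Seq (Load r a) P') s T Q \<longleftrightarrow>
     1 \<le> T \<and> runs w P' (s\<lparr>regs := (regs s)(r := mem s (regs s a))\<rparr>) (T - 1) Q"
  "runs w (Seq (Store a r) P') s T Q \<longleftrightarrow>
     1 \<le> T \<and> runs w P' (s\<lparr>mem := (mem s)(regs s a := regs s r)\<rparr>) (T - 1) Q"
  "runs w (Seq (Output r) P') s T Q \<longleftrightarrow>
     1 \<le> T \<and> runs w P' (s\<lparr>outp := outp s @ [regs s r]\<rparr>) (T - 1) Q"
  by (rule runs_Seq_unit; simp add: exec_basic)+

text \<open>A branch of \<open>IfLess\<close> may itself be a sequence; once
  \<open>runs_Seq_If\<close> has put it before the remaining program, reassociation exposes its
  first instruction.\<close>

lemma runs_Seq_assoc [simp]: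
  "runs w (Seq (Seq P P') P'') s T Q \<longleftrightarrow> runs w (Seq P (Seq P' P'')) s T Q"
proof -
  have "exec w (Seq (Seq P P') P'') s t s' \<longleftrightarrow> exec w (Seq P (Seq P' P'')) s t s'" for t s'
    unfolding exec_Seq_iff by (safe; metis add.assoc)
  then show ?thesis by (simp add: runs_def)
qed

lemma runs_Seq_If [simp]:
  "runs w (Seq (IfLess a b P P') P'') s T Q \<longleftrightarrow>
     1 \<le> T \<and> runs w (Seq (if regs s a < regs s b then P else P') P'') s (T - 1) Q"
proof -
  let ?P = "if regs s a < regs s b then P else P'"
  have "exec w (Seq (IfLess a b P P') P'') s t s' \<longleftrightarrow>
      (\<exists>t1. t = t1 + 1 \<and> exec w (Seq ?P P'') s t1 s')" for t s'
    unfolding exec_Seq_iff exec_If_iff by (safe; metis add.assoc add.commute)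
  moreover have "(\<exists>t s'. (\<exists>t1. t = t1 + 1 \<and> R t1 s') \<and> t \<le> T \<and> Q s') \<longleftrightarrow>
      1 \<le> T \<and> (\<exists>t s'. R t s' \<and> t \<le> T - 1 \<and> Q s')" for R
    by (cases T) auto
  ultimately show ?thesis unfolding runs_def by simp
qed

text \<open>
  The second argument of the invariant is the time still allowed; since it decreases in every
  iteration, it also serves as the termination measure.
\<close>

lemma runs_While:
  assumes "I s T"
    and step: "\<And>s T. I s T \<Longrightarrow> regs s a < regs s b \<Longrightarrow>
      \<exists>T1 T2. T1 + T2 + 1 \<le> T \<and> runs w P s T1 (\<lambda>s'. I s' T2)"
    and exit: "\<And>s T. I s T \<Longrightarrow> \<not> regs s a < regs s b \<Longrightarrow> 1 \<le> T \<and> Q s"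
  shows "runs w (WhileLess a b P) s T Q"
  using assms(1)
proof (induction T arbitrary: s rule: less_induct)
  case (less T)
  show ?case
  proof (cases "regs s a < regs s b")
    case True
    from step[OF less.prems True] obtain T1 T2 t s' where
      1: "T1 + T2 + 1 \<le> T" "exec w P s t s'" "t \<le> T1" "I s' T2" by (auto simp: runs_def)
    from less.IH[OF _ 1(4)] 1(1) obtain t' s'' where
      2: "exec w (WhileLess a b P) s' t' s''" "t' \<le> T2" "Q s''" by (auto simp: runs_def)
    have "t + t' + 1 \<le> T" using 1 2 by linarith
    then show ?thesis using exec.WhileTrue[OF True 1(2) 2(1)] 2(3) unfolding runs_def by blast
  next
    case False
    then show ?thesis using exit[OF less.prems False] exec.WhileFalse unfolding runs_def by blast
  qed
qed

text \<open>The cost \<open>c i\<close> may vary with the counter, as it does in the loop over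
  vertices of different degrees. Each summand includes the successful test; the leading 1 is the
  final failing test. That the body advances the counter is enforced by the invariant through
  \<open>ctr\<close>.\<close>

lemma runs_for:
  assumes "I lo s" "lo \<le> hi"
    and ctr: "\<And>i s. I i s \<Longrightarrow> regs s a = i \<and> regs s b = hi"
    and step: "\<And>i s. I i s \<Longrightarrow> lo \<le> i \<Longrightarrow> i < hi \<Longrightarrow> runs w P s (c i) (I (Suc i))"
  shows "runs w (WhileLess a b P) s (1 + (\<Sum>i=lo..<hi. c i + 1)) (I hi)"
proof (rule runs_While[where I = "\<lambda>s T. \<exists>i. lo \<le> i \<and> i \<le> hi \<and> I i s \<and> T = 1 + (\<Sum>i=i..<hi. c i + 1)"])
  show "\<exists>i. lo \<le> i \<and> i \<le> hi \<and> I i s \<and> 1 + (\<Sum>i=lo..<hi. c i + 1) = 1 + (\<Sum>i=i..<hi. c i + 1)"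
    using assms by blast
next
  fix s T
  assume "\<exists>i. lo \<le> i \<and> i \<le> hi \<and> I i s \<and> T = 1 + (\<Sum>i=i..<hi. c i + 1)" and l: "regs s a < regs s b"
  then obtain i where i: "lo \<le> i" "i \<le> hi" "I i s" "T = 1 + (\<Sum>i=i..<hi. c i + 1)" by blast
  then have lt: "i < hi" using ctr[OF i(3)] l by simp
  have "runs w P s (c i) (\<lambda>s'. \<exists>j. lo \<le> j \<and> j \<le> hi \<and> I j s' \<and>
      1 + (\<Sum>i=Suc i..<hi. c i + 1) = 1 + (\<Sum>i=j..<hi. c i + 1))"
    using step[OF i(3,1) lt] by (rule runs_mono) (use i lt in \<open>auto intro!: exI[of _ "Suc i"]\<close>)
  moreover have "c i + (1 + (\<Sum>i=Suc i..<hi. c i + 1)) + 1 \<le> T"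
    using i(4) lt by (simp add: sum.atLeast_Suc_lessThan)
  ultimately show "\<exists>T1 T2. T1 + T2 + 1 \<le> T \<and> runs w P s T1 (\<lambda>s'. \<exists>j. lo \<le> j \<and> j \<le> hi \<and> I j s' \<and>
      T2 = 1 + (\<Sum>i=j..<hi. c i + 1))" by blast
next
  fix s T
  assume "\<exists>i. lo \<le> i \<and> i \<le> hi \<and> I i s \<and> T = 1 + (\<Sum>i=i..<hi. c i + 1)" and l: "\<not> regs s a < regs s b"
  then show "1 \<le> T \<and> I hi s" using ctr by force
qed

section \<open>The program\<close>

text \<open>
  The status array starts at the end of the input, whose address is held in \<open>rB\<close>, and the queue
  of the search follows at the address in \<open>rQ\<close>. While neighbour \<open>x\<close> of \<open>v\<close> is tested, the status
  of a vertex is 2 if it is \<open>v\<close> or has been visited, 1 if it is an unvisited neighbour of \<open>v\<close>,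
  and 0 otherwise; only vertices found with status 0 enter the queue. Registers are numbered by
  decreasing lifetime, so that every subprogram preserves an initial segment of them.
\<close>

abbreviation (input) rZ :: reg where "rZ \<equiv> 0"
abbreviation (input) rOne :: reg where "rOne \<equiv> 1"
abbreviation (input) rTwo :: reg where "rTwo \<equiv> 2"
abbreviation (input) rN :: reg where "rN \<equiv> 3"
abbreviation (input) rB :: reg where "rB \<equiv> 4"
abbreviation (input) rQ :: reg where "rQ \<equiv> 5"
abbreviation (input) rV :: reg where "rV \<equiv> 6"
abbreviation (input) rPs :: reg where "rPs \<equiv> 7"
abbreviation (input) rPe :: reg where "rPe \<equiv> 8"
abbreviation (input) rPx :: reg where "rPx \<equiv> 9"
abbreviation (input) rX :: reg where "rX \<equiv> 10"
abbreviation (input) rBad :: reg where "rBad \<equiv> 11"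
abbreviation (input) rH :: reg where "rH \<equiv> 12"
abbreviation (input) rT :: reg where "rT \<equiv> 13"
abbreviation (input) rP :: reg where "rP \<equiv> 14"
abbreviation (input) rL :: reg where "rL \<equiv> 15"
abbreviation (input) rA :: reg where "rA \<equiv> 16"
abbreviation (input) rC :: reg where "rC \<equiv> 17"
abbreviation (input) rY :: reg where "rY \<equiv> 18"

abbreviation (input) sequence :: "com \<Rightarrow> com \<Rightarrow> com" (infixr \<open>;;\<close> 60) where
  "P ;; Q \<equiv> Seq P Q"

text \<open>All searches share the status array, so it is reset each time, at a cost linear in
  \<open>n\<close>. The queue needs no reset: its cells are written before they are read.\<close>

definition clear_prog :: com where
  "clear_prog = Add rP rB rZ ;; WhileLess rP rQ (Store rP rZ ;; Add rP rP rOne)"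

definition mark_prog :: com where
  "mark_prog = Add rP rPs rZ ;;
     WhileLess rP rPe (Load rY rP ;; Add rA rB rY ;; Store rA rOne ;; Add rP rP rOne)"

text \<open>Since \<open>v\<close> is not in its own list, marking leaves it at status 0; without
  the explicit 2 the scan of \<open>x\<close> would enqueue it.\<close>

definition seed_prog :: com where
  "seed_prog = Add rA rB rV ;; Store rA rTwo ;; Add rA rB rX ;; Store rA rTwo ;;
     Store rQ rX ;; Add rH rQ rZ ;; Add rT rQ rOne"

definition scan_prog :: com where
  "scan_prog = WhileLess rP rL (Load rY rP ;; Add rA rB rY ;; Load rC rA ;; Store rA rTwo ;;
     IfLess rC rOne (Store rT rY ;; Add rT rT rOne) Skip ;; Add rP rP rOne)"

definition search_prog :: com where
  "search_prog = WhileLess rH rT (Load rY rH ;; Add rH rH rOne ;; Add rA rY rOne ;; Load rP rA ;;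
     Add rA rA rOne ;; Load rL rA ;; scan_prog)"

text \<open>The flag is only ever raised here, so it accumulates failures over all neighbours
  \<open>x\<close> of the same \<open>v\<close>.\<close>

definition check_prog :: com where
  "check_prog = Add rP rPs rZ ;; WhileLess rP rPe (Load rY rP ;; Add rA rB rY ;; Load rC rA ;;
     IfLess rC rTwo (Const rBad 1) Skip ;; Add rP rP rOne)"

definition neighbour_prog :: com where
  "neighbour_prog = Load rX rPx ;; clear_prog ;; mark_prog ;; seed_prog ;; search_prog ;;
     check_prog ;; Add rPx rPx rOne"

definition vertex_prog :: com where
  "vertex_prog = Const rBad 0 ;; Add rA rV rOne ;; Load rPs rA ;; Add rA rA rOne ;; Load rPe rA ;;
     Add rPx rPs rZ ;; WhileLess rPx rPe neighbour_prog ;;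
     IfLess rBad rOne (Output rV) Skip ;; Add rV rV rOne"

text \<open>\<open>rZ\<close> and \<open>rV\<close> rely on registers being 0 initially. The pointer
  at address \<open>n + 1\<close> marks the end of the last list, hence of the input, and becomes
  \<open>rB\<close>.\<close>

definition main_prog :: com where
  "main_prog = Const rOne 1 ;; Const rTwo 2 ;; Load rN rZ ;; Add rA rN rOne ;; Load rB rA ;;
     Add rQ rB rN ;; WhileLess rV rN vertex_prog"

section \<open>Correctness and running time\<close>

text \<open>Each edge is \<open>{a, b}\<close> for at most two ordered pairs. This is the handshake
  bound in the form used for summing degrees.\<close>

lemma card_arcs_le:
  assumes "finite E"
  shows "card {(a, b). {a, b} \<in> E \<and> a \<noteq> b} \<le> 2 * card E"
proof -
  have two: "finite {(a, b). {a, b} = e \<and> a \<noteq> b} \<and> card {(a, b). {a, b} = e \<and> a \<noteq> b} \<le> 2" for e :: "'a set"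
  proof (cases "\<exists>a b. e = {a, b}")
    case True
    then obtain a b where "e = {a, b}" by blast
    then have sub: "{(a, b). {a, b} = e \<and> a \<noteq> b} \<subseteq> {(a, b), (b, a)}" by (auto simp: doubleton_eq_iff)
    have "card {(a, b), (b, a)} \<le> 2" using card_length[of "[(a, b), (b, a)]"] by simp
    then show ?thesis using card_mono[OF _ sub] finite_subset[OF sub] by simp
  next
    case False
    then have "{(a, b). {a, b} = e \<and> a \<noteq> b} = {}" by auto
    then show ?thesis by (simp only: card.empty finite.emptyI simp_thms)
  qed
  have "{(a, b). {a, b} \<in> E \<and> a \<noteq> b} = (\<Union>e\<in>E. {(a, b). {a, b} = e \<and> a \<noteq> b})" by auto
  also have "card \<dots> \<le> (\<Sum>e\<in>E. card {(a, b). {a, b} = e \<and> a \<noteq> b})" by (rule card_UN_le[OF assms])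
  also have "\<dots> \<le> (\<Sum>e\<in>E. 2)" by (rule sum_mono) (use two in blast)
  finally show ?thesis by simp
qed

section \<open>Memory layout of the input and word size\<close>

locale graph_input =
  fixes n m w :: nat and E :: "nat set set" and adj :: "nat list list"
  assumes G: "simple_graph {..<n} E" and card_E: "card E = m" and adj: "adjacency_lists n E adj"
    and word: "(n + m + 2) ^ 4 \<le> 2 ^ w"
begin

definition off :: "nat \<Rightarrow> nat" where
  "off v = n + 2 + length (concat (take v adj))"

abbreviation base :: nat where "base \<equiv> off n"

lemma length_adj: "length adj = n"
  using adj by (simp add: adjacency_lists_def)

lemma adj_nth:
  assumes "v < n"
  shows "distinct (adj ! v)" "set (adj ! v) = {u. {v, u} \<in> E}" "set (adj ! v) \<subseteq> {..<n}"
  using adj assms edge_distinct(3)[OF G] by (auto simp: adjacency_lists_def)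

lemma length_adj_nth_le:
  assumes "v < n"
  shows "length (adj ! v) \<le> n"
proof -
  have "length (adj ! v) = card (set (adj ! v))" using adj_nth(1)[OF assms] by (simp add: distinct_card)
  also have "\<dots> \<le> card {..<n}" by (rule card_mono) (use adj_nth(3)[OF assms] in auto)
  finally show ?thesis by simp
qed

lemma off_Suc: "v < n \<Longrightarrow> off (Suc v) = off v + length (adj ! v)"
  using length_adj by (simp add: off_def take_Suc_conv_app_nth)

lemma off_eq_sum: "v \<le> n \<Longrightarrow> off v = n + 2 + (\<Sum>u<v. length (adj ! u))"
proof (induction v)
  case 0
  then show ?case by (simp add: off_def)
next
  case (Suc v)
  then show ?case using off_Suc[of v] by simp
qed

lemma off_mono:
  assumes "u \<le> v" "v \<le> n"
  shows "off u \<le> off v"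
proof -
  have "(\<Sum>u<u. length (adj ! u)) \<le> (\<Sum>u<v. length (adj ! u))"
    by (rule sum_mono2) (use assms in auto)
  then show ?thesis using off_eq_sum assms by simp
qed

lemma sum_degrees_le: "(\<Sum>u<n. length (adj ! u)) \<le> 2 * m"
proof -
  have fin: "finite E"
    using G by (intro finite_subset[of E "Pow {..<n}"]) (auto simp: simple_graph_def)
  have "(\<Sum>u<n. length (adj ! u)) = (\<Sum>u<n. card (set (adj ! u)))"
    by (rule sum.cong) (simp_all add: adj_nth(1) distinct_card)
  also have "\<dots> = card (SIGMA u:{..<n}. set (adj ! u))" by simp
  also have "\<dots> \<le> card {(a, b). {a, b} \<in> E \<and> a \<noteq> b}"
  proof (rule card_mono)
    have "{(a, b). {a, b} \<in> E \<and> a \<noteq> b} \<subseteq> {..<n} \<times> {..<n}"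
      using edge_distinct[OF G] by auto
    then show "finite {(a, b). {a, b} \<in> E \<and> a \<noteq> b}" by (rule finite_subset) simp
    show "(SIGMA u:{..<n}. set (adj ! u)) \<subseteq> {(a, b). {a, b} \<in> E \<and> a \<noteq> b}"
      using adj_nth(2) edge_distinct[OF G] by auto
  qed
  also have "\<dots> \<le> 2 * m" using card_arcs_le[OF fin] card_E by simp
  finally show ?thesis .
qed

text \<open>The left side is at most \<open>8 * (n + m + 2)\<close> by the degree sum, and the
  exponent 4 supplies the factor 8, since the base is at least 2. The bound covers all addresses of
  the input, the status array and the queue.\<close>

lemma word_bound: "base + 4 * n + 4 \<le> 2 ^ w"
proof -
  let ?N = "n + m + 2"
  have "2 ^ 3 \<le> ?N ^ 3" by (rule power_mono) auto
  then have "8 * ?N \<le> ?N ^ 3 * ?N" by (intro mult_right_mono) auto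
  also have "\<dots> = ?N ^ 4" by (simp add: eval_nat_numeral)
  finally have "8 * ?N \<le> 2 ^ w" using word by linarith
  moreover have "base + 4 * n + 4 \<le> 8 * ?N"
    using off_eq_sum[OF order_refl] sum_degrees_le by simp
  ultimately show ?thesis by (rule order_trans[rotated])
qed

lemma length_encode: "length (encode adj) = base"
  using length_adj by (simp add: encode_def Let_def off_def)

lemma encode_0: "encode adj ! 0 = n"
  using length_adj by (simp add: encode_def Let_def)

lemma encode_pointer:
  assumes "v \<le> n"
  shows "encode adj ! Suc v = off v"
  using length_adj assms by (simp add: encode_def Let_def nth_append off_def del: upt_Suc)

lemma encode_neighbour:
  assumes "v < n" "j < length (adj ! v)"
  shows "encode adj ! (off v + j) = adj ! v ! j"
proof -
  have "adj = take v adj @ adj ! v # drop (Suc v) adj"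
    using assms length_adj by (simp add: id_take_nth_drop)
  then have "concat adj = concat (take v adj) @ adj ! v @ concat (drop (Suc v) adj)"
    by (metis concat.simps(2) concat_append)
  then have "concat adj ! (length (concat (take v adj)) + j) = adj ! v ! j"
    using assms by (simp add: nth_append)
  then show ?thesis
    using length_adj by (simp add: encode_def Let_def nth_append off_def del: upt_Suc)
qed

definition input :: "ram_state \<Rightarrow> bool" where
  "input s \<longleftrightarrow> (\<forall>i<base. mem s i = encode adj ! i)"

lemma base_gt: "n + 1 < base"
  by (simp add: off_def)

lemma input_0: "input s \<Longrightarrow> mem s 0 = n"
  using encode_0 base_gt by (simp add: input_def)

lemma input_pointer: "input s \<Longrightarrow> v \<le> n \<Longrightarrow> mem s (Suc v) = off v"
  using encode_pointer base_gt by (simp add: input_def)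

lemma input_neighbour:
  assumes "input s" "v < n" "j < length (adj ! v)"
  shows "mem s (off v + j) = adj ! v ! j" "adj ! v ! j < n" "off v + j < base"
proof -
  show "off v + j < base" using off_Suc[of v] off_mono[of "Suc v" n] assms by simp
  then show "mem s (off v + j) = adj ! v ! j" using assms encode_neighbour by (simp add: input_def)
  show "adj ! v ! j < n" using adj_nth(3)[OF assms(2)] nth_mem[OF assms(3)] by blast
qed

section \<open>Frame conditions\<close>

definition setup_regs :: "ram_state \<Rightarrow> bool" where
  "setup_regs s \<longleftrightarrow> regs s rZ = 0 \<and> regs s rOne = 1 \<and> regs s rTwo = 2 \<and> regs s rN = n \<and>
     regs s rB = base \<and> regs s rQ = base + n"

text \<open>The frame condition of a subprogram whose lowest written register is \<open>k\<close>.
  Only the input part of memory is protected; status array and queue may change freely.\<close>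

definition keeps :: "nat \<Rightarrow> ram_state \<Rightarrow> ram_state \<Rightarrow> bool" where
  "keeps k s s' \<longleftrightarrow> input s' \<and> outp s' = outp s \<and> (\<forall>r<k. regs s' r = regs s r)"

lemma keeps_trans: "keeps k s s' \<Longrightarrow> keeps k' s' s'' \<Longrightarrow> j \<le> k \<Longrightarrow> j \<le> k' \<Longrightarrow> keeps j s s''"
  by (simp add: keeps_def)

lemma keeps_setup: "keeps k s s' \<Longrightarrow> setup_regs s \<Longrightarrow> 6 \<le> k \<Longrightarrow> setup_regs s'"
  by (simp add: keeps_def setup_regs_def)

lemma runs_for_adj:
  assumes v: "v < n" and "I 0 s"
    and ctr: "\<And>j s. I j s \<Longrightarrow> regs s a = off v + j \<and> regs s b = off (Suc v)"
    and step: "\<And>j s. I j s \<Longrightarrow> j < length (adj ! v) \<Longrightarrow> runs w P s c (I (Suc j))"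
  shows "runs w (WhileLess a b P) s (1 + length (adj ! v) * (c + 1)) (I (length (adj ! v)))"
proof -
  have "runs w (WhileLess a b P) s (1 + (\<Sum>i=off v..<off (Suc v). c + 1))
      (\<lambda>s. off v \<le> off (Suc v) \<and> I (off (Suc v) - off v) s)"
  \<comment> \<open>The conjunct \<open>off v \<le> i\<close> makes the truncated difference
    \<open>i - off v\<close> faithful.\<close>
  proof (rule runs_for[where I = "\<lambda>i s. off v \<le> i \<and> I (i - off v) s"])
    show "off v \<le> off v \<and> I (off v - off v) s" using assms by simp
    show "off v \<le> off (Suc v)" using off_Suc[OF v] by simp
    show "regs s a = i \<and> regs s b = off (Suc v)" if "off v \<le> i \<and> I (i - off v) s" for i s
      using ctr[of "i - off v" s] that by simp
    show "runs w P s c (\<lambda>s. off v \<le> Suc i \<and> I (Suc i - off v) s)"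
      if "off v \<le> i \<and> I (i - off v) s" "off v \<le> i" "i < off (Suc v)" for i s
      using step[of "i - off v" s] that off_Suc[OF v] by (simp add: Suc_diff_le less_diff_conv2)
  qed
  then show ?thesis by (rule runs_mono) (use off_Suc[OF v] in auto)
qed

lemma mod_word [simp]:
  "1 mod 2 ^ w = (1::nat)" "Suc 0 mod 2 ^ w = Suc 0" "2 mod 2 ^ w = (2::nat)" "0 < w"
proof -
  have *: "2 < (2::nat) ^ w" using word_bound by linarith
  then show "0 < w" by (cases w) auto
  show "1 mod 2 ^ w = (1::nat)" "Suc 0 mod 2 ^ w = Suc 0" "2 mod 2 ^ w = (2::nat)"
    using * by (simp_all only: mod_less One_nat_def)
qed

section \<open>Preparing the status array\<close>

lemma clear_runs:
  assumes c: "setup_regs s" and inp: "input s"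
  shows "runs w clear_prog s (3 * n + 2) (\<lambda>s'. keeps 14 s s' \<and> (\<forall>z<n. mem s' (base + z) = 0))"
proof -
  let ?I = "\<lambda>i t. keeps 14 s t \<and> regs t rP = i \<and> (\<forall>j. base \<le> j \<and> j < i \<longrightarrow> mem t j = 0)"
  let ?s = "s\<lparr>regs := (regs s)(rP := base)\<rparr>"
  have "runs w (WhileLess rP rQ (Store rP rZ ;; Add rP rP rOne)) ?s
      (1 + (\<Sum>i=base..<base + n. 2 + 1)) (?I (base + n))"
  proof (rule runs_for)
    show "?I base ?s" using inp by (simp add: keeps_def input_def)
    show "regs t rP = i \<and> regs t rQ = base + n" if "?I i t" for i t
      using that keeps_setup[OF _ c] by (auto simp: setup_regs_def)
    show "runs w (Store rP rZ ;; Add rP rP rOne) t 2 (?I (Suc i))"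
      if I: "?I i t" and i: "base \<le> i" "i < base + n" for i t
    proof -
      have "setup_regs t" using I keeps_setup[OF _ c] by auto
      moreover have "Suc i mod 2 ^ w = Suc i" using i word_bound by simp
      ultimately show ?thesis using I i by (auto simp: setup_regs_def keeps_def input_def less_Suc_eq)
    qed
  qed simp
  moreover have "base mod 2 ^ w = base" using word_bound by simp
  ultimately show ?thesis using c
    by (auto simp: clear_prog_def setup_regs_def elim!: runs_mono)
qed

lemma mark_runs:
  assumes c: "setup_regs s" and inp: "input s" and v: "v < n"
    and ptr: "regs s rPs = off v" "regs s rPe = off (Suc v)"
    and z: "\<forall>z<n. mem s (base + z) = 0"
  shows "runs w mark_prog s (5 * length (adj ! v) + 2)
    (\<lambda>s'. keeps 14 s s' \<and> (\<forall>z<n. mem s' (base + z) = (if z \<in> set (adj ! v) then 1 else 0)))"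
proof -
  let ?I = "\<lambda>j t. keeps 14 s t \<and> regs t rP = off v + j \<and>
    (\<forall>z<n. mem t (base + z) = (if z \<in> set (take j (adj ! v)) then 1 else 0))"
  let ?s = "s\<lparr>regs := (regs s)(rP := off v)\<rparr>"
  have "runs w (WhileLess rP rPe (Load rY rP ;; Add rA rB rY ;; Store rA rOne ;; Add rP rP rOne)) ?s
      (1 + length (adj ! v) * (4 + 1)) (?I (length (adj ! v)))"
  proof (rule runs_for_adj[OF v])
    show "?I 0 ?s" using inp z by (simp add: keeps_def input_def)
    show "regs t rP = off v + j \<and> regs t rPe = off (Suc v)" if "?I j t" for j t
      using that ptr by (simp add: keeps_def)
    show "runs w (Load rY rP ;; Add rA rB rY ;; Store rA rOne ;; Add rP rP rOne) t 4 (?I (Suc j))"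
      if I: "?I j t" and j: "j < length (adj ! v)" for j t
    proof -
      have "setup_regs t" using I keeps_setup[OF _ c] by auto
      moreover have "input t" using I by (simp add: keeps_def)
      note nb = input_neighbour[OF this v j]
      moreover have "Suc (off v + j) mod 2 ^ w = Suc (off v + j)" using nb word_bound by simp
      moreover have "(base + adj ! v ! j) mod 2 ^ w = base + adj ! v ! j" using nb word_bound by simp
      ultimately show ?thesis using I j
        by (auto simp: setup_regs_def keeps_def input_def take_Suc_conv_app_nth)
    qed
  qed
  moreover have "off v mod 2 ^ w = off v" using word_bound off_mono[of v n] v by simp
  ultimately show ?thesis using c ptr
    by (auto simp: mark_prog_def setup_regs_def elim!: runs_mono)
qed

section \<open>Breadth-first search\<close>

text \<open>Separates the memory layout from the combinatorial state \<open>S\<close>,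
  \<open>q\<close>, so that the correctness of the search can be argued without the machine.\<close>

definition img :: "ram_state \<Rightarrow> (nat \<Rightarrow> nat) \<Rightarrow> nat list \<Rightarrow> bool" where
  "img s S q \<longleftrightarrow> (\<forall>z<n. mem s (base + z) = S z) \<and> (\<forall>i<length q. mem s (base + n + i) = q ! i)"

text \<open>Statuses change during the scan, yet the new queue entries are described by the old
  \<open>S\<close>: the list has no repetitions, so each vertex still has its old status when it is
  met.\<close>

lemma scan_runs:
  assumes c: "setup_regs s" and inp: "input s" and u: "u < n"
    and ptr: "regs s rP = off u" "regs s rL = off (Suc u)" "regs s rT = base + n + length q"
    and q: "length q \<le> n" and S: "img s S q"
  defines "q' \<equiv> q @ filter (\<lambda>z. S z = 0) (adj ! u)"
  shows "runs w scan_prog s (9 * length (adj ! u) + 1)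
    (\<lambda>s'. keeps 13 s s' \<and> img s' (\<lambda>z. if z \<in> set (adj ! u) then 2 else S z) q' \<and>
       regs s' rT = base + n + length q')"
proof -
  let ?q = "\<lambda>j. q @ filter (\<lambda>z. S z = 0) (take j (adj ! u))"
  let ?I = "\<lambda>j t. keeps 13 s t \<and> regs t rP = off u + j \<and> regs t rL = off (Suc u) \<and>
    img t (\<lambda>z. if z \<in> set (take j (adj ! u)) then 2 else S z) (?q j) \<and>
    regs t rT = base + n + length (?q j)"
  have "runs w scan_prog s (1 + length (adj ! u) * (8 + 1)) (?I (length (adj ! u)))"
    unfolding scan_prog_def
  proof (rule runs_for_adj[OF u])
    show "?I 0 s" using inp ptr S by (simp add: keeps_def)
    show "regs t rP = off u + j \<and> regs t rL = off (Suc u)" if "?I j t" for j t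
      using that by simp
    show "runs w (Load rY rP ;; Add rA rB rY ;; Load rC rA ;; Store rA rTwo ;;
        IfLess rC rOne (Store rT rY ;; Add rT rT rOne) Skip ;; Add rP rP rOne) t 8 (?I (Suc j))"
      if I: "?I j t" and j: "j < length (adj ! u)" for j t
    proof -
      define z where "z = adj ! u ! j"
      have ct: "setup_regs t" using I keeps_setup[OF _ c] by auto
      have "input t" using I by (simp add: keeps_def)
      note nb = input_neighbour[OF this u j, folded z_def]
      have p: "Suc (off u + j) mod 2 ^ w = Suc (off u + j)" using nb word_bound by simp
      have bz: "(base + z) mod 2 ^ w = base + z" using nb word_bound by simp
      \<comment> \<open>Without knowledge about repetitions in the queue, its length is bounded by
        \<open>2 * n\<close>; the slack of \<open>word_bound\<close> permits this.\<close>
      have "length (filter (\<lambda>z. S z = 0) (take j (adj ! u))) \<le> n"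
        using length_adj_nth_le[OF u] j length_filter_le[of "\<lambda>z. S z = 0" "take j (adj ! u)"] by simp
      then have t: "Suc (base + n + length (?q j)) mod 2 ^ w = Suc (base + n + length (?q j))"
        using word_bound q by simp
      have take: "take (Suc j) (adj ! u) = take j (adj ! u) @ [z]"
        using j by (simp add: take_Suc_conv_app_nth z_def)
      have "z \<notin> set (take j (adj ! u))"
        using adj_nth(1)[OF u] j take by (metis distinct_take distinct_append disjoint_iff list.set_intros(1))
      then have Sz: "mem t (base + z) = S z" using I nb by (simp add: img_def)
      note facts = nb(1) Sz p bz t take ct[unfolded setup_regs_def]
      have keep: "keeps 13 s t'" if "outp t' = outp t" "\<And>r. r < 13 \<Longrightarrow> regs t' r = regs t r"
        "\<And>i. i < base \<Longrightarrow> mem t' i = mem t i" for t'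
        using I that by (simp add: keeps_def input_def)
      show ?thesis
      proof (cases "S z = 0")
        case True
        have img: "img t' (\<lambda>y. if y = z \<or> y \<in> set (take j (adj ! u)) then 2 else S y)
            (q @ filter (\<lambda>z. S z = 0) (take j (adj ! u)) @ [z])"
          if "mem t' = (mem t)(base + z := 2, base + n + length (?q j) := z)" for t'
          using I nb(2) that by (auto simp: img_def nth_append less_Suc_eq)
        show ?thesis using I True facts by (simp add: keep img add.assoc)
      next
        case False
        have img: "img t' (\<lambda>y. if y = z \<or> y \<in> set (take j (adj ! u)) then 2 else S y) (?q j)"
          if "mem t' = (mem t)(base + z := 2)" for t'
          using I nb(2) that by (auto simp: img_def)
        show ?thesis using I False facts by (simp add: keep img add.assoc)
      qed
    qed
  qed
  then show ?thesis by (rule runs_mono) (auto simp: q'_def)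
qed

text \<open>The first \<open>h\<close> entries of the queue \<open>q\<close> have been expanded.\<close>

definition search_inv :: "nat \<Rightarrow> nat \<Rightarrow> nat \<Rightarrow> (nat \<Rightarrow> nat) \<Rightarrow> nat list \<Rightarrow> bool" where
  "search_inv v x h S q \<longleftrightarrow> distinct q \<and> set q \<subseteq> {..<n} \<and> x \<in> set q \<and> h \<le> length q \<and>
     S x = 2 \<and> (\<forall>u\<in>set q. reach E v x u) \<and>
     (\<forall>z<n. S z \<le> 2) \<and>
     (\<forall>z<n. S z = 0 \<longleftrightarrow> z \<noteq> v \<and> {v, z} \<notin> E \<and> z \<notin> set q) \<and>
     (\<forall>z<n. S z = 2 \<longrightarrow> z = v \<or> z \<in> set q \<or> (\<exists>u\<in>set q. {u, z} \<in> E)) \<and>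
     (\<forall>u\<in>set (take h q). \<forall>z. {u, z} \<in> E \<longrightarrow> S z = 2)"

lemma search_inv_init:
  assumes v: "v < n" and x: "{v, x} \<in> E"
  shows "search_inv v x 0
    (\<lambda>z. if z = v \<or> z = x then 2 else if z \<in> set (adj ! v) then 1 else 0) [x]"
proof -
  have "x < n" "v \<noteq> x" using edge_distinct[OF G x] by auto
  moreover have "z \<in> set (adj ! v) \<longleftrightarrow> {v, z} \<in> E" for z using adj_nth(2)[OF v] by simp
  ultimately show ?thesis using x by (simp add: search_inv_def reach.start)
qed

text \<open>A scanned vertex of status 0 is one that \<open>reach.step\<close> admits and that is
  not yet queued, so appending it preserves both reachability and distinctness. Other scanned
  vertices merely get status 2, justified by their edge to \<open>u\<close>.\<close>

lemma search_inv_step: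
  assumes inv: "search_inv v x h S q" and h: "h < length q"
  defines "u \<equiv> q ! h"
  shows "search_inv v x (Suc h) (\<lambda>z. if z \<in> set (adj ! u) then 2 else S z)
    (q @ filter (\<lambda>z. S z = 0) (adj ! u))"
proof -
  have uq: "u \<in> set q" using h by (simp add: u_def)
  then have u: "u < n" using inv by (auto simp: search_inv_def)
  note a = adj_nth[OF u]
  have free: "z \<noteq> v \<and> {v, z} \<notin> E \<and> z \<notin> set q" if "z \<in> set (adj ! u)" "S z = 0" for z
    using inv that a(3) by (auto simp: search_inv_def)
  have reach: "reach E v x z" if "z \<in> set (adj ! u)" "S z = 0" for z
  proof -
    have "reach E v x u" using inv uq by (auto simp: search_inv_def)
    then show ?thesis using free[OF that] that(1) a(2) reach.step[of E v x u z] by blast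
  qed
  have take: "take (Suc h) (q @ filter (\<lambda>z. S z = 0) (adj ! u)) = take h q @ [u]"
    using h by (simp add: take_Suc_conv_app_nth u_def)
  show ?thesis
    unfolding search_inv_def take
  proof (intro conjI)
    show "distinct (q @ filter (\<lambda>z. S z = 0) (adj ! u))"
      using inv a(1) free by (auto simp: search_inv_def)
    show "set (q @ filter (\<lambda>z. S z = 0) (adj ! u)) \<subseteq> {..<n}"
      using inv a(3) by (auto simp: search_inv_def)
    show "\<forall>y\<in>set (q @ filter (\<lambda>z. S z = 0) (adj ! u)). reach E v x y"
      using inv reach by (auto simp: search_inv_def)
    show "\<forall>z<n. (if z \<in> set (adj ! u) then 2 else S z) = 2 \<longrightarrow> z = v \<or>
        z \<in> set (q @ filter (\<lambda>z. S z = 0) (adj ! u)) \<or>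
        (\<exists>y\<in>set (q @ filter (\<lambda>z. S z = 0) (adj ! u)). {y, z} \<in> E)"
      using inv uq a(2) unfolding search_inv_def by auto
    show "\<forall>y\<in>set (take h q @ [u]). \<forall>z. {y, z} \<in> E \<longrightarrow> (if z \<in> set (adj ! u) then 2 else S z) = 2"
      using inv a(2) unfolding search_inv_def by auto
    show "\<forall>z<n. ((if z \<in> set (adj ! u) then 2 else S z) = 0) =
        (z \<noteq> v \<and> {v, z} \<notin> E \<and> z \<notin> set (q @ filter (\<lambda>z. S z = 0) (adj ! u)))"
    proof (intro allI impI)
      fix z assume "z < n"
      then have "S z = 0 \<longleftrightarrow> z \<noteq> v \<and> {v, z} \<notin> E \<and> z \<notin> set q" using inv by (simp add: search_inv_def)
      then show "((if z \<in> set (adj ! u) then 2 else S z) = 0) =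
          (z \<noteq> v \<and> {v, z} \<notin> E \<and> z \<notin> set (q @ filter (\<lambda>z. S z = 0) (adj ! u)))" by auto
    qed
  qed (use inv h in \<open>simp_all add: search_inv_def\<close>)
qed

text \<open>Once everything queued is expanded, the queue contains all reachable vertices: the
  successor of an expanded vertex has status 2, and the exact description of status 0 then puts
  every admissible successor into the queue.\<close>

lemma search_inv_final:
  assumes inv: "search_inv v x (length q) S q" and v: "v < n" and x: "{v, x} \<in> E"
  shows "(\<forall>y\<in>set (adj ! v). S y = 2) \<longleftrightarrow> good_neighbour E v x"
proof -
  have closed: "u \<in> set q" if "reach E v x u" for u
    using that
  proof induction
    case start
    then show ?case using inv by (simp add: search_inv_def)
  next
    case (step u z)
    then have "S z = 2" "z < n" using inv edge_distinct(3)[OF G] by (auto simp: search_inv_def)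
    then show ?case using inv step.hyps by (auto simp: search_inv_def)
  qed
  \<comment> \<open>A neighbour of \<open>v\<close> is never entered by \<open>reach.step\<close>,
    so the only one that can be queued is the start.\<close>
  have in_q: "y = x" if "reach E v x y" "{v, y} \<in> E" for y
    using that by (cases rule: reach.cases) auto
  have "S y = 2 \<longleftrightarrow> y = x \<or> (\<exists>u. reach E v x u \<and> {u, y} \<in> E)" if y: "{v, y} \<in> E" for y
  proof
    assume "S y = 2"
    moreover have "y < n" "y \<noteq> v" using edge_distinct[OF G y] by auto
    ultimately have "y \<in> set q \<or> (\<exists>u\<in>set q. {u, y} \<in> E)" using inv by (auto simp: search_inv_def)
    then show "y = x \<or> (\<exists>u. reach E v x u \<and> {u, y} \<in> E)"
      using inv in_q[OF _ y] by (auto simp: search_inv_def)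
  next
    assume "y = x \<or> (\<exists>u. reach E v x u \<and> {u, y} \<in> E)"
    then show "S y = 2" using inv closed by (auto simp: search_inv_def)
  qed
  then show ?thesis using adj_nth(2)[OF v] by (auto simp: good_neighbour_def)
qed

lemma search_runs:
  assumes c: "setup_regs s" and inp: "input s" and S: "img s S q" "search_inv v x 0 S q"
    and ptr: "regs s rH = base + n" "regs s rT = base + n + length q"
  shows "runs w search_prog s (1 + (\<Sum>z<n. 9 * length (adj ! z) + 8))
    (\<lambda>s'. \<exists>S q. search_inv v x (length q) S q \<and> img s' S q \<and> keeps 12 s s')"
proof -
  \<comment> \<open>Expanding \<open>z\<close> takes six instructions, a scan of
    \<open>9 * length (adj ! z) + 1\<close> steps and one loop test.\<close>
  let ?f = "\<lambda>z. 9 * length (adj ! z) + 8"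
  \<comment> \<open>The queue has no repetitions, so the unexpanded vertices pay for the remaining search.\<close>
  let ?I = "\<lambda>t T. \<exists>S q h. search_inv v x h S q \<and> img t S q \<and> keeps 12 s t \<and>
    regs t rH = base + n + h \<and> regs t rT = base + n + length q \<and>
    T = 1 + sum ?f ({..<n} - set (take h q))"
  show ?thesis
    unfolding search_prog_def
  proof (rule runs_While[where I = ?I])
    show "?I s (1 + (\<Sum>z<n. ?f z))"
      using S ptr inp by (intro exI[of _ S] exI[of _ q] exI[of _ 0]) (simp add: keeps_def)
    show "1 \<le> T \<and> (\<exists>S q. search_inv v x (length q) S q \<and> img t S q \<and> keeps 12 s t)"
      if "?I t T" "\<not> regs t rH < regs t rT" for t T
    proof -
      from that(1) obtain S q h where i: "search_inv v x h S q" "img t S q" "keeps 12 s t"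
        "regs t rH = base + n + h" "regs t rT = base + n + length q"
        "T = 1 + sum ?f ({..<n} - set (take h q))" by blast
      then have "h = length q" using that(2) by (simp add: search_inv_def)
      then show ?thesis using i by auto
    qed
    show "\<exists>T1 T2. T1 + T2 + 1 \<le> T \<and> runs w (Load rY rH ;; Add rH rH rOne ;; Add rA rY rOne ;;
        Load rP rA ;; Add rA rA rOne ;; Load rL rA ;; scan_prog) t T1 (\<lambda>s'. ?I s' T2)"
      if I: "?I t T" and less: "regs t rH < regs t rT" for t T
    proof -
      from I obtain S q h where i: "search_inv v x h S q" "img t S q" "keeps 12 s t"
        "regs t rH = base + n + h" "regs t rT = base + n + length q"
        "T = 1 + sum ?f ({..<n} - set (take h q))" by blast
      define u where "u = q ! h"
      define q' where "q' = q @ filter (\<lambda>z. S z = 0) (adj ! u)"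
      define S' where "S' = (\<lambda>z. if z \<in> set (adj ! u) then 2 else S z)"
      have h: "h < length q" using less i by simp
      have dq: "distinct q" "set q \<subseteq> {..<n}" using i(1) by (auto simp: search_inv_def)
      then have u: "u < n" using nth_mem[OF h] by (auto simp: u_def)
      have lq: "length q \<le> n" using card_mono[OF finite_lessThan dq(2)] distinct_card[OF dq(1)] by simp
      have ct: "setup_regs t" using keeps_setup[OF i(3) c] by simp
      have it: "input t" using i(3) by (simp add: keeps_def)
      have memu: "mem t (base + n + h) = u" using i(2) h by (simp add: img_def u_def)
      have mods: "Suc (base + n + h) mod 2 ^ w = Suc (base + n + h)" "Suc u mod 2 ^ w = Suc u"
        "Suc (Suc u) mod 2 ^ w = Suc (Suc u)"
        using word_bound h lq u by simp_all
      have ptrs: "mem t (Suc u) = off u" "mem t (Suc (Suc u)) = off (Suc u)"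
        using input_pointer[OF it] u by simp_all
      define t' where "t' = t\<lparr>regs := (regs t)(rY := u, rH := Suc (base + n + h), rA := Suc u,
        rP := off u, rA := Suc (Suc u), rL := off (Suc u))\<rparr>"
      have "runs w scan_prog t' (9 * length (adj ! u) + 1) (\<lambda>s'. keeps 13 t' s' \<and> img s' S' q' \<and>
         regs s' rT = base + n + length q')"
        unfolding S'_def q'_def
      proof (rule scan_runs[OF _ _ u])
        show "setup_regs t'" using ct by (simp add: t'_def setup_regs_def)
        show "input t'" using it by (simp add: t'_def input_def)
        show "img t' S q" using i(2) by (simp add: t'_def img_def)
      qed (use i lq in \<open>simp_all add: t'_def\<close>)
      then have "runs w scan_prog t' (9 * length (adj ! u) + 1)
        (\<lambda>s'. ?I s' (1 + sum ?f ({..<n} - set (take (Suc h) q'))))"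
      proof (rule runs_mono)
        fix s' assume s': "keeps 13 t' s' \<and> img s' S' q' \<and> regs s' rT = base + n + length q'"
        have "search_inv v x (Suc h) S' q'"
          unfolding S'_def q'_def u_def by (rule search_inv_step[OF i(1) h])
        moreover have "keeps 12 s s'" using s' i(3) by (simp add: keeps_def t'_def)
        moreover have "regs s' rH = base + n + Suc h" using s' by (simp add: keeps_def t'_def)
        ultimately show "?I s' (1 + sum ?f ({..<n} - set (take (Suc h) q')))" using s' by blast
      qed simp
      then have "runs w (Load rY rH ;; Add rH rH rOne ;; Add rA rY rOne ;;
        Load rP rA ;; Add rA rA rOne ;; Load rL rA ;; scan_prog) t (9 * length (adj ! u) + 7)
        (\<lambda>s'. ?I s' (1 + sum ?f ({..<n} - set (take (Suc h) q'))))"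
        using ct memu mods ptrs i(4) by (simp add: t'_def setup_regs_def)
      moreover have "sum ?f ({..<n} - set (take h q)) =
          ?f u + sum ?f ({..<n} - set (take (Suc h) q'))"
      proof -
        have take: "take (Suc h) q' = take h q @ [u]"
          using h by (simp add: take_Suc_conv_app_nth u_def q'_def)
        have "u \<notin> set (take h q)"
          using dq(1) h by (auto simp: u_def in_set_conv_nth nth_eq_iff_index_eq)
        then show ?thesis using u by (subst sum.remove[of _ u]) (auto simp: take intro: sum.cong)
      qed
      then have "9 * length (adj ! u) + 7 + (1 + sum ?f ({..<n} - set (take (Suc h) q'))) + 1 \<le> T"
        using i(6) by simp
      ultimately show ?thesis by blast
    qed
  qed
qed

section \<open>Testing a neighbour, a vertex, the whole graph\<close>

lemma check_runs:
  assumes c: "setup_regs s" and inp: "input s" and v: "v < n"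
    and ptr: "regs s rPs = off v" "regs s rPe = off (Suc v)"
    and S: "\<forall>z<n. mem s (base + z) = S z \<and> S z \<le> 2"
  shows "runs w check_prog s (7 * length (adj ! v) + 2) (\<lambda>s'. keeps 11 s s' \<and>
    regs s' rBad = (if \<forall>y\<in>set (adj ! v). S y = 2 then regs s rBad else 1))"
proof -
  let ?I = "\<lambda>j t. keeps 11 s t \<and> regs t rP = off v + j \<and> (\<forall>z<n. mem t (base + z) = S z) \<and>
    regs t rBad = (if \<forall>y\<in>set (take j (adj ! v)). S y = 2 then regs s rBad else 1)"
  let ?s = "s\<lparr>regs := (regs s)(rP := off v)\<rparr>"
  have "runs w (WhileLess rP rPe (Load rY rP ;; Add rA rB rY ;; Load rC rA ;;
      IfLess rC rTwo (Const rBad 1) Skip ;; Add rP rP rOne)) ?s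
      (1 + length (adj ! v) * (6 + 1)) (?I (length (adj ! v)))"
  proof (rule runs_for_adj[OF v])
    show "?I 0 ?s" using inp S by (simp add: keeps_def input_def)
    show "regs t rP = off v + j \<and> regs t rPe = off (Suc v)" if "?I j t" for j t
      using that ptr by (simp add: keeps_def)
    show "runs w (Load rY rP ;; Add rA rB rY ;; Load rC rA ;;
      IfLess rC rTwo (Const rBad 1) Skip ;; Add rP rP rOne) t 6 (?I (Suc j))"
      if I: "?I j t" and j: "j < length (adj ! v)" for j t
    proof -
      define y where "y = adj ! v ! j"
      have ct: "setup_regs t" using I keeps_setup[OF _ c] by auto
      have "input t" using I by (simp add: keeps_def)
      note nb = input_neighbour[OF this v j, folded y_def]
      have p: "Suc (off v + j) mod 2 ^ w = Suc (off v + j)" using nb word_bound by simp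
      have by_word: "(base + y) mod 2 ^ w = base + y" using nb word_bound by simp
      have take: "take (Suc j) (adj ! v) = take j (adj ! v) @ [y]"
        using j by (simp add: take_Suc_conv_app_nth y_def)
      have Sy: "mem t (base + y) = S y" "S y \<le> 2" using I S nb(2) by auto
      note facts = nb(1) Sy p by_word take ct[unfolded setup_regs_def]
      have keep: "keeps 11 s t'" if "outp t' = outp t" "\<And>r. r < 11 \<Longrightarrow> regs t' r = regs t r"
        "\<And>i. i < base \<Longrightarrow> mem t' i = mem t i" for t'
        using I that by (simp add: keeps_def input_def)
      show ?thesis
      proof (cases "S y = 2")
        case True
        then show ?thesis using I facts by (simp add: keep)
      next
        case False
        then have "S y < 2" using Sy by simp
        then show ?thesis using I False facts by (simp add: keep)
      qed
    qed
  qed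
  moreover have "off v mod 2 ^ w = off v" using word_bound off_mono[of v n] v by simp
  ultimately show ?thesis using c ptr
    by (auto simp: check_prog_def setup_regs_def elim!: runs_mono)
qed

lemma seed_runs:
  assumes c: "setup_regs s" and inp: "input s" and v: "v < n" "regs s rV = v"
    and x: "x < n" "regs s rX = x"
    and S: "\<forall>z<n. mem s (base + z) = (if z \<in> set (adj ! v) then 1 else 0)"
  shows "runs w seed_prog s 7 (\<lambda>s'. keeps 12 s s' \<and>
    img s' (\<lambda>z. if z = v \<or> z = x then 2 else if z \<in> set (adj ! v) then 1 else 0) [x] \<and>
    regs s' rH = base + n \<and> regs s' rT = base + n + length [x])"
proof -
  have "(base + v) mod 2 ^ w = base + v" "(base + x) mod 2 ^ w = base + x"
    "(base + n) mod 2 ^ w = base + n" "Suc (base + n) mod 2 ^ w = Suc (base + n)"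
    using v x word_bound by simp_all
  then show ?thesis using assms
    by (auto simp: seed_prog_def setup_regs_def keeps_def input_def img_def)
qed

lemma neighbour_runs:
  assumes c: "setup_regs s" and inp: "input s" and v: "v < n" "regs s rV = v"
    and ptr: "regs s rPs = off v" "regs s rPe = off (Suc v)" "regs s rPx = off v + j"
    and j: "j < length (adj ! v)"
  shows "runs w neighbour_prog s (25 * (n + m + 1)) (\<lambda>s'. keeps 9 s s' \<and>
    regs s' rPx = off v + Suc j \<and>
    regs s' rBad = (if good_neighbour E v (adj ! v ! j) then regs s rBad else 1))"
proof -
  define x where "x = adj ! v ! j"
  define d where "d = length (adj ! v)"
  define K where "K = 1 + (\<Sum>z<n. 9 * length (adj ! z) + 8)"
  note nb = input_neighbour[OF inp v(1) j, folded x_def]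
  have vx: "{v, x} \<in> E" using nth_mem[OF j] adj_nth(2)[OF v(1)] by (simp add: x_def)
  have dn: "d \<le> n" using length_adj_nth_le[OF v(1)] by (simp add: d_def)
  have K: "K \<le> 18 * m + 8 * n + 1"
    using sum_degrees_le by (simp add: K_def sum.distrib flip: sum_distrib_left)
  define s1 where "s1 = s\<lparr>regs := (regs s)(rX := x)\<rparr>"
  have s1: "setup_regs s1" "input s1" "keeps 10 s s1" "regs s1 rX = x" "regs s1 rBad = regs s rBad"
    using c inp by (simp_all add: s1_def setup_regs_def input_def keeps_def)
  let ?post = "\<lambda>s'. keeps 9 s s' \<and> regs s' rPx = off v + Suc j \<and>
    regs s' rBad = (if good_neighbour E v x then regs s rBad else 1)"
  let ?T = "3 * n + 2 + (5 * d + 2 + (7 + (K + (7 * d + 2 + 1))))"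
  have "runs w (clear_prog ;; mark_prog ;; seed_prog ;; search_prog ;; check_prog ;;
      Add rPx rPx rOne) s1 ?T ?post"
  proof (rule runs_Seq_add[OF clear_runs[OF s1(1,2)]])
    fix s2 assume s2: "keeps 14 s1 s2 \<and> (\<forall>z<n. mem s2 (base + z) = 0)"
    have k2: "keeps 10 s s2" "setup_regs s2" "input s2"
      using s1 s2 keeps_setup[of 14 s1 s2] by (auto simp: keeps_def)
    have "runs w (mark_prog ;; seed_prog ;; search_prog ;; check_prog ;; Add rPx rPx rOne) s2
        (5 * d + 2 + (7 + (K + (7 * d + 2 + 1)))) ?post"
      unfolding d_def
    proof (rule runs_Seq_add[OF mark_runs[OF k2(2,3) v(1)]])
      show "regs s2 rPs = off v" "regs s2 rPe = off (Suc v)" using k2(1) ptr by (simp_all add: keeps_def)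
      show "\<forall>z<n. mem s2 (base + z) = 0" using s2 by blast
      fix s3 assume s3: "keeps 14 s2 s3 \<and>
        (\<forall>z<n. mem s3 (base + z) = (if z \<in> set (adj ! v) then 1 else 0))"
      have k3: "keeps 10 s s3" "setup_regs s3" "input s3"
        using k2 s3 keeps_setup[of 14 s2 s3] by (auto simp: keeps_def)
      have r3: "regs s3 rX = x" "regs s3 rBad = regs s rBad" using s1 s2 s3 by (simp_all add: keeps_def)
      have "runs w (seed_prog ;; search_prog ;; check_prog ;; Add rPx rPx rOne) s3
          (7 + (K + (7 * d + 2 + 1))) ?post"
      proof (rule runs_Seq_add[OF seed_runs[OF k3(2,3) v(1) _ nb(2) r3(1)]], goal_cases)
        case 1
        then show ?case using k3(1) v(2) by (simp add: keeps_def)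
      next
        case 2
        then show ?case using s3 by blast
      next
        case (3 s4)
        then have k4: "keeps 10 s s4" "setup_regs s4" "input s4" "regs s4 rBad = regs s rBad"
          using k3 r3 keeps_setup[of 12 s3 s4] by (auto simp: keeps_def)
        from 3 have i4: "img s4 (\<lambda>z. if z = v \<or> z = x then 2 else if z \<in> set (adj ! v) then 1 else 0) [x]"
          "regs s4 rH = base + n" "regs s4 rT = base + n + length [x]" by blast+
        have "runs w (search_prog ;; check_prog ;; Add rPx rPx rOne) s4 (K + (7 * d + 2 + 1)) ?post"
          unfolding K_def
        proof (rule runs_Seq_add[OF search_runs[OF k4(2,3) i4(1) search_inv_init[OF v(1) vx] i4(2,3)]])
          fix s5 assume s5: "\<exists>S q. search_inv v x (length q) S q \<and> img s5 S q \<and> keeps 12 s4 s5"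
          then obtain S q where inv: "search_inv v x (length q) S q" and img: "img s5 S q"
            and k45: "keeps 12 s4 s5" by blast
          have k5: "keeps 10 s s5" "setup_regs s5" "input s5" "regs s5 rBad = regs s rBad"
            using k4 k45 keeps_setup[of 12 s4 s5] by (auto simp: keeps_def)
          have S2: "\<forall>z<n. mem s5 (base + z) = S z \<and> S z \<le> 2"
            using inv img by (simp add: search_inv_def img_def)
          have "runs w (check_prog ;; Add rPx rPx rOne) s5 (7 * d + 2 + 1) ?post"
            unfolding d_def
          proof (rule runs_Seq_add[OF check_runs[OF k5(2,3) v(1) _ _ S2]])
            show "regs s5 rPs = off v" "regs s5 rPe = off (Suc v)"
              using k5(1) ptr by (simp_all add: keeps_def)
            fix s6 assume s6: "keeps 11 s5 s6 \<and>
              regs s6 rBad = (if \<forall>y\<in>set (adj ! v). S y = 2 then regs s5 rBad else 1)"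
            have k6: "keeps 10 s s6" "setup_regs s6"
              using k5 s6 keeps_setup[of 11 s5 s6] by (auto simp: keeps_def)
            have "regs s6 rPx = off v + j" "regs s6 rOne = 1"
              using k6 ptr by (simp_all add: keeps_def setup_regs_def)
            moreover have "Suc (off v + j) mod 2 ^ w = Suc (off v + j)" using nb word_bound by simp
            moreover have "keeps 9 s t" if "outp t = outp s6" "mem t = mem s6"
              "\<And>r. r < 9 \<Longrightarrow> regs t r = regs s6 r" for t
              using that k6(1) by (simp add: keeps_def input_def)
            moreover have "regs s6 rBad = (if good_neighbour E v x then regs s rBad else 1)"
              using s6 k5(4) search_inv_final[OF inv v(1) vx] by simp
            ultimately show "runs w (Add rPx rPx rOne) s6 1 ?post" by simp
          qed
          then show "runs w (check_prog ;; Add rPx rPx rOne) s5 (7 * d + 2 + 1) ?post" .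
        qed
        then show ?case .
      qed
      then show "runs w (seed_prog ;; search_prog ;; check_prog ;; Add rPx rPx rOne) s3
        (7 + (K + (7 * length (adj ! v) + 2 + 1))) ?post" unfolding d_def .
    qed
    then show "runs w (mark_prog ;; seed_prog ;; search_prog ;; check_prog ;; Add rPx rPx rOne) s2
        (5 * d + 2 + (7 + (K + (7 * d + 2 + 1)))) ?post" .
  qed
  \<comment> \<open>With \<open>d \<le> n\<close> and the bound on \<open>K\<close>, the left side
    is at most \<open>23 * n + 18 * m + 16\<close>.\<close>
  moreover have "?T + 1 \<le> 25 * (n + m + 1)" using dn K by simp
  ultimately have "runs w (clear_prog ;; mark_prog ;; seed_prog ;; search_prog ;; check_prog ;;
      Add rPx rPx rOne) s1 (25 * (n + m + 1) - 1) ?post"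
    by (elim runs_mono) simp_all
  then show ?thesis
    unfolding neighbour_prog_def using nb(1) ptr(3) by (simp add: s1_def x_def)
qed

text \<open>The loop tests all neighbours in turn, and \<open>avoidable_iff_good_neighbours\<close>
  interprets the flag. An isolated vertex skips the loop and is output, in accordance with its
  vacuous avoidability.\<close>

lemma vertex_runs:
  assumes c: "setup_regs s" and inp: "input s" and v: "v < n" "regs s rV = v"
  shows "runs w vertex_prog s (11 + length (adj ! v) * (25 * (n + m + 1) + 1))
    (\<lambda>s'. setup_regs s' \<and> input s' \<and> regs s' rV = Suc v \<and>
       outp s' = outp s @ (if avoidable {..<n} E v then [v] else []))"
proof -
  define s1 where "s1 = s\<lparr>regs := (regs s)(rBad := 0, rA := Suc v, rPs := off v,
    rA := Suc (Suc v), rPe := off (Suc v), rPx := off v)\<rparr>"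
  let ?L = "1 + length (adj ! v) * (25 * (n + m + 1) + 1)"
  let ?I = "\<lambda>j t. keeps 9 s1 t \<and> regs t rPx = off v + j \<and>
    regs t rBad = (if \<forall>x\<in>set (take j (adj ! v)). good_neighbour E v x then 0 else 1)"
  have s1: "setup_regs s1" "input s1"
    using c inp by (simp_all add: s1_def setup_regs_def input_def)
  have loop: "runs w (WhileLess rPx rPe neighbour_prog) s1 ?L (?I (length (adj ! v)))"
  proof (rule runs_for_adj[OF v(1)])
    show "?I 0 s1" using s1(2) by (simp add: keeps_def s1_def)
    show "regs t rPx = off v + j \<and> regs t rPe = off (Suc v)" if "?I j t" for j t
      using that by (simp add: keeps_def s1_def)
    show "runs w neighbour_prog t (25 * (n + m + 1)) (?I (Suc j))"
      if I: "?I j t" and j: "j < length (adj ! v)" for j t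
    proof (rule runs_mono[OF neighbour_runs[OF _ _ v(1) _ _ _ _ j]])
      show "setup_regs t" using I keeps_setup[OF _ s1(1)] by auto
      show "input t" "regs t rV = v" "regs t rPs = off v" "regs t rPe = off (Suc v)"
        using I v(2) by (simp_all add: keeps_def s1_def)
      show "regs t rPx = off v + j" using I by blast
      show "?I (Suc j) t'" if "keeps 9 t t' \<and> regs t' rPx = off v + Suc j \<and>
        regs t' rBad = (if good_neighbour E v (adj ! v ! j) then regs t rBad else 1)" for t'
        using I that keeps_trans[of 9 s1 t 9 t' 9] j by (auto simp: take_Suc_conv_app_nth)
    qed simp
  qed
  have "runs w (WhileLess rPx rPe neighbour_prog ;;
      IfLess rBad rOne (Output rV) Skip ;; Add rV rV rOne) s1 (?L + 4)
      (\<lambda>s'. setup_regs s' \<and> input s' \<and> regs s' rV = Suc v \<and>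
       outp s' = outp s @ (if avoidable {..<n} E v then [v] else []))"
  proof (rule runs_Seq[OF loop], simp)
    fix t assume I: "?I (length (adj ! v)) t"
    have ct: "setup_regs t" using I keeps_setup[OF _ s1(1)] by auto
    have t: "input t" "regs t rV = v" "outp t = outp s"
      using I v(2) by (simp_all add: keeps_def s1_def)
    have bad: "regs t rBad = (if avoidable {..<n} E v then 0 else 1)"
      using I avoidable_iff_good_neighbours[OF G, of v] adj_nth(2)[OF v(1)] v(1) by simp
    have "Suc v mod 2 ^ w = Suc v" using v word_bound by simp
    then show "runs w (IfLess rBad rOne (Output rV) Skip ;; Add rV rV rOne) t (?L + 4 - ?L)
      (\<lambda>s'. setup_regs s' \<and> input s' \<and> regs s' rV = Suc v \<and>
       outp s' = outp s @ (if avoidable {..<n} E v then [v] else []))"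
      using bad t ct by (simp add: setup_regs_def input_def)
  qed
  moreover have "Suc v mod 2 ^ w = Suc v" "Suc (Suc v) mod 2 ^ w = Suc (Suc v)" "off v mod 2 ^ w = off v"
    using v word_bound off_mono[of v n] by simp_all
  moreover have "mem s (Suc v) = off v" "mem s (Suc (Suc v)) = off (Suc v)"
    using input_pointer[OF inp] v(1) by simp_all
  ultimately show ?thesis
    using c v(2) by (simp add: vertex_prog_def s1_def setup_regs_def)
qed

lemma main_runs:
  "runs w main_prog (init_state (encode adj)) (7 + 12 * n + 2 * m * (25 * (n + m + 1) + 1))
     (\<lambda>s. outp s = filter (avoidable {..<n} E) [0..<n])"
proof -
  let ?s = "init_state (encode adj)"
  let ?K = "25 * (n + m + 1) + 1"
  define s1 where "s1 = ?s\<lparr>regs := (regs ?s)(rOne := 1, rTwo := 2, rN := n, rA := Suc n,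
    rB := base, rQ := base + n)\<rparr>"
  have inp: "input ?s" by (simp add: input_def init_state_def length_encode)
  let ?I = "\<lambda>v t. setup_regs t \<and> input t \<and> regs t rV = v \<and> outp t = filter (avoidable {..<n} E) [0..<v]"
  have "runs w (WhileLess rV rN vertex_prog) s1
      (1 + (\<Sum>v=0..<n. 11 + length (adj ! v) * ?K + 1)) (?I n)"
  proof (rule runs_for[where I = ?I])
    show "?I 0 s1" using inp by (simp add: s1_def setup_regs_def input_def init_state_def)
    show "regs t rV = v \<and> regs t rN = n" if "?I v t" for v t
      using that by (simp add: setup_regs_def)
    show "runs w vertex_prog t (11 + length (adj ! v) * ?K) (?I (Suc v))"
      if I: "?I v t" and "v < n" for v t
      by (rule runs_mono[OF vertex_runs[of t v]]) (use that in auto)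
  qed simp
  moreover have "1 + (\<Sum>v=0..<n. 11 + length (adj ! v) * ?K + 1) \<le> 1 + 12 * n + 2 * m * ?K"
  proof -
    \<comment> \<open>Stated for arbitrary \<open>f\<close> and \<open>k\<close>, because the actual
      factor contains \<open>n\<close> and must stay fixed during the induction on the number of
      summands.\<close>
    have "(\<Sum>v=0..<i. 11 + f v * k + 1) = 12 * i + (\<Sum>v<i. f v) * k" for f k and i :: nat
      by (induction i) (simp_all add: algebra_simps)
    then have "(\<Sum>v=0..<n. 11 + length (adj ! v) * ?K + 1) = 12 * n + (\<Sum>v<n. length (adj ! v)) * ?K" .
    also have "\<dots> \<le> 12 * n + 2 * m * ?K"
      using mult_le_mono1[OF sum_degrees_le, of ?K] by simp
    finally show ?thesis by simp
  qed
  ultimately have "runs w (WhileLess rV rN vertex_prog) s1 (1 + 12 * n + 2 * m * ?K)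
      (\<lambda>s. outp s = filter (avoidable {..<n} E) [0..<n])"
    by (elim runs_mono) simp_all
  moreover have "Suc n mod 2 ^ w = Suc n" "(base + n) mod 2 ^ w = base + n"
    using word_bound base_gt by simp_all
  moreover have "mem ?s 0 = n" "mem ?s (Suc n) = base"
    using input_0[OF inp] input_pointer[OF inp, of n] by simp_all
  moreover have "regs ?s r = 0" for r by (simp add: init_state_def)
  ultimately show ?thesis by (simp add: main_prog_def s1_def)
qed

end

text \<open>The product \<open>n * m\<close> is controlled by the square of the difference, taken
  over \<open>int\<close> since subtraction on \<open>nat\<close> truncates. The
  \<open>max 1\<close> absorbs the constant steps spent even on the empty graph.\<close>

lemma time_bound:
  fixes n m :: nat
  shows "7 + 12 * n + 2 * m * (25 * (n + m + 1) + 1) \<le> 200 * max 1 (n\<^sup>2 + m\<^sup>2)"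
proof -
  have "2 * (int n * int m) \<le> (int n)\<^sup>2 + (int m)\<^sup>2"
    using zero_le_power2[of "int n - int m"] by (simp add: power2_diff)
  then have "int (2 * (n * m)) \<le> int (n\<^sup>2 + m\<^sup>2)" by simp
  then have nm: "2 * (n * m) \<le> n\<^sup>2 + m\<^sup>2" by (simp only: of_nat_le_iff)
  have sq: "n \<le> n\<^sup>2" "m \<le> m\<^sup>2" by (simp_all add: power2_eq_square)
  \<comment> \<open>The products are replaced by variables \<open>p\<close>, \<open>a\<close>,
    \<open>b\<close>, which leaves a linear problem; the left side is in fact at most
    \<open>134 * M\<close>.\<close>
  have linear: "7 + 12 * n + (50 * p + 50 * b + 52 * m) \<le> 200 * M"
    if "2 * p \<le> a + b" "n \<le> a" "m \<le> b" "1 \<le> M" "a + b \<le> M" for p a b M :: nat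
    using that by simp
  have "2 * m * (25 * (n + m + 1) + 1) = 50 * (n * m) + 50 * m\<^sup>2 + 52 * m"
    by (simp add: power2_eq_square algebra_simps)
  then show ?thesis using linear[OF nm sq max.cobounded1 max.cobounded2] by (simp only:)
qed

theorem theorem21:
  "\<exists>(P :: com) (k :: nat) (C :: nat).
     \<forall>(n :: nat) (m :: nat) (E :: nat set set) (adj :: nat list list) (w :: nat).
       simple_graph {..<n} E \<longrightarrow> card E = m \<longrightarrow> adjacency_lists n E adj \<longrightarrow>
       (n + m + 2) ^ k \<le> 2 ^ w \<longrightarrow>
       (\<exists>t s. exec w P (init_state (encode adj)) t s \<and>
          t \<le> C * max 1 (n\<^sup>2 + m\<^sup>2) \<and>
          distinct (outp s) \<and> set (outp s) = {v. avoidable {..<n} E v})"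
proof (rule exI[of _ main_prog], rule exI[of _ 4], rule exI[of _ 200], intro allI impI)
  fix n m w :: nat and E :: "nat set set" and adj :: "nat list list"
  assume "simple_graph {..<n} E" "card E = m" "adjacency_lists n E adj" "(n + m + 2) ^ 4 \<le> 2 ^ w"
  then interpret graph_input n m w E adj by unfold_locales
  \<comment> \<open>\<open>avoidable\<close> includes membership in the vertex set, so filtering
    \<open>[0..<n]\<close> misses nothing.\<close>
  have "set (filter (avoidable {..<n} E) [0..<n]) = {v. avoidable {..<n} E v}"
    by (auto simp: avoidable_def)
  moreover obtain t s where "exec w main_prog (init_state (encode adj)) t s"
    and t: "t \<le> 7 + 12 * n + 2 * m * (25 * (n + m + 1) + 1)" and "outp s = filter (avoidable {..<n} E) [0..<n]"
    using main_runs unfolding runs_def by blast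
  moreover have "t \<le> 200 * max 1 (n\<^sup>2 + m\<^sup>2)" using t time_bound by (rule order_trans)
  ultimately show "\<exists>t s. exec w main_prog (init_state (encode adj)) t s \<and>
      t \<le> 200 * max 1 (n\<^sup>2 + m\<^sup>2) \<and>
      distinct (outp s) \<and> set (outp s) = {v. avoidable {..<n} E v}"
    by (intro exI[of _ t] exI[of _ s]) simp
qed

end
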